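(* Fix $\rho\in[0,1)$ and let $P_\infty$ be the $\infty$-MTpCN kernel $$P_\infty(x,dy)=\alpha(x,y)\,\bar Q(x,dy)+\delta_x(dy)\int_{\mathcal X}(1-\alpha(x,u))\,\bar Q(x,du),$$ $$\bar Q(x,dy)=\frac{e^{-\Phi(y)}Q(x,dy)}{\int e^{-\Phi(u)}Q(x,du)},\qquad \alpha(x,y)=1\wedge\frac{\int e^{-\Phi(z)}Q(x,dz)}{\int e^{-\Phi(u)}Q(y,du)},$$ where $Q(x,\cdot)=\mathcal N(\rho x,(1-\rho^2)\mathcal C)$. Assume $\Phi:\mathcal X\to\mathbb R$ is globally bounded and globally Lipschitz with respect to $\|\cdot\|$ with constant $L_\Phi$. Let $V$ be any one of the functions $V(x)=\|x\|^k$ with $k\in\mathbb N$; $V(x)=\exp(v\|x\|)$ with $v>0$; or $V(x)=\exp(v\|x\|^2)$ with $v>0$ sufficiently small. Then there exists $\varepsilon^*\in(0,1)$ so that for any $\varepsilon\in(0,\varepsilon^* )$ there are $\lambda\in(0,1)$ and $n_1\in\mathbb N$ such that for all Borel probability measures $\nu_1,\nu_2$ on $\mathcal X$, $$W_{\tilde d_\varepsilon}(\nu_1P_\infty^n,\nu_2P_\infty^n)\le\lambda^n\,W_{\tilde d_\varepsilon}(\nu_1,\nu_2)\quad\text{for all } n\ge n_1,$$ where $\tilde d_\varepsilon(x,\tilde x)=\sqrt{d_\varepsilon(x,\tilde x)\,(1+V(x)+V(\tilde x))}$ and $d_\varepsilon(x,\tilde x)=1\wedge\varepsilon^{-1}\|x-\tilde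 x\|$.
   Context: $\mathcal X$ is a separable Hilbert space with norm $\|\cdot\|$; $\mathcal N(m,\mathcal K)$ denotes the Gaussian measure on $\mathcal X$ with mean $m$ and covariance operator $\mathcal K$; $\mathcal C$ is a linear, symmetric, strictly positive-definite, trace-class operator on $\mathcal X$. For a Markov kernel $P$ and a measure $\nu$, $\nu P(A)=\int P(x,A)\,\nu(dx)$, and $P^n$ is the $n$-step kernel. $W_{\tilde d}(\nu_1,\nu_2)=\inf_\pi\int\tilde d(x,y)\,\pi(dx,dy)$, the infimum over all couplings $\pi$ of $\nu_1,\nu_2$. "$v$ sufficiently small" means $0<v\le v_0$ for some $v_0>0$. *)

theory Defs
  imports "HOL-Probability.Probability"
begin

definition orthonormal_basis :: "'a::real_inner set \<Rightarrow> bool" where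
  "orthonormal_basis B \<longleftrightarrow>
     pairwise orthogonal B \<and> (\<forall>b\<in>B. norm b = 1) \<and> closure (span B) = UNIV"

definition symmetric_operator :: "('a::real_inner \<Rightarrow> 'a) \<Rightarrow> bool" where
  "symmetric_operator A \<longleftrightarrow> (\<forall>x y. A x \<bullet> y = x \<bullet> A y)"

definition strictly_positive_operator :: "('a::real_inner \<Rightarrow> 'a) \<Rightarrow> bool" where
  "strictly_positive_operator A \<longleftrightarrow> (\<forall>x. x \<noteq> 0 \<longrightarrow> 0 < A x \<bullet> x)"

text \<open>\<open>T\<close> is the absolute value \<open>(A\<^sup>* A)\<^sup>1\<^sup>/\<^sup>2\<close> of \<open>A\<close>; the equation \<open>T\<^sup>2 = A\<^sup>* A\<close> is
  written weakly, so that no adjoint is needed.\<close>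

definition is_absolute_value :: "('a::real_inner \<Rightarrow> 'a) \<Rightarrow> ('a \<Rightarrow> 'a) \<Rightarrow> bool" where
  "is_absolute_value A T \<longleftrightarrow>
     bounded_linear T \<and> symmetric_operator T \<and> (\<forall>x. 0 \<le> T x \<bullet> x) \<and>
     (\<forall>x y. T x \<bullet> T y = A x \<bullet> A y)"

text \<open>The trace of the positive operator \<open>T\<close> does not depend on the choice of the orthonormal
  basis, so it is enough that it is finite for one.\<close>

definition trace_class_operator :: "('a::real_inner \<Rightarrow> 'a) \<Rightarrow> bool" where
  "trace_class_operator A \<longleftrightarrow> bounded_linear A \<and>
     (\<exists>T B. is_absolute_value A T \<and> orthonormal_basis B \<and> (\<lambda>e. T e \<bullet> e) summable_on B)"

definition real_gaussian :: "real \<Rightarrow> real \<Rightarrow> real measure" where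
  "real_gaussian m v =
     (if v = 0 then return borel m
      else density lborel (\<lambda>t. ennreal (normal_density m (sqrt v) t)))"

text \<open>\<open>M\<close> is the Gaussian measure with mean \<open>m\<close> and covariance operator \<open>K\<close>: every
  one-dimensional projection \<open>\<langle>\<cdot>, h\<rangle>\<close> has law \<open>N(\<langle>m, h\<rangle>, \<langle>K h, h\<rangle>)\<close>. For symmetric \<open>K\<close> this
  determines \<open>M\<close>.\<close>

definition is_gaussian_measure ::
  "'a::real_inner measure \<Rightarrow> 'a \<Rightarrow> ('a \<Rightarrow> 'a) \<Rightarrow> bool" where
  "is_gaussian_measure M m K \<longleftrightarrow> prob_space M \<and> sets M = sets borel \<and>
     (\<forall>h. distr M borel (\<lambda>x. x \<bullet> h) = real_gaussian (m \<bullet> h) (K h \<bullet> h))"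

definition norm_const :: "('a \<Rightarrow> 'a measure) \<Rightarrow> ('a \<Rightarrow> real) \<Rightarrow> 'a \<Rightarrow> real" where
  "norm_const Q \<Phi> x = (\<integral>u. exp (- \<Phi> u) \<partial>Q x)"

definition Qbar :: "('a \<Rightarrow> 'a measure) \<Rightarrow> ('a \<Rightarrow> real) \<Rightarrow> 'a \<Rightarrow> 'a measure" where
  "Qbar Q \<Phi> x = density (Q x) (\<lambda>y. ennreal (exp (- \<Phi> y) / norm_const Q \<Phi> x))"

definition acceptance :: "('a \<Rightarrow> 'a measure) \<Rightarrow> ('a \<Rightarrow> real) \<Rightarrow> 'a \<Rightarrow> 'a \<Rightarrow> real" where
  "acceptance Q \<Phi> x y = min 1 (norm_const Q \<Phi> x / norm_const Q \<Phi> y)"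

definition MTpCN_inf ::
  "('a::topological_space \<Rightarrow> 'a measure) \<Rightarrow> ('a \<Rightarrow> real) \<Rightarrow> 'a \<Rightarrow> 'a measure" where
  "MTpCN_inf Q \<Phi> x = measure_of UNIV (sets borel) (\<lambda>A.
     (\<integral>\<^sup>+y. ennreal (acceptance Q \<Phi> x y) * indicator A y \<partial>Qbar Q \<Phi> x)
     + indicator A x * (\<integral>\<^sup>+u. ennreal (1 - acceptance Q \<Phi> x u) \<partial>Qbar Q \<Phi> x))"

text \<open>The \<open>n\<close>-step kernel; \<open>\<nu> P\<close> is the Giry bind \<open>bind \<nu> P\<close>.\<close>

primrec kernel_pow ::
  "('a::topological_space \<Rightarrow> 'a measure) \<Rightarrow> nat \<Rightarrow> 'a \<Rightarrow> 'a measure" where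
  "kernel_pow P 0 = (\<lambda>x. return borel x)"
| "kernel_pow P (Suc n) = (\<lambda>x. bind (kernel_pow P n x) P)"

definition couplings ::
  "'a::topological_space measure \<Rightarrow> 'a measure \<Rightarrow> ('a \<times> 'a) measure set" where
  "couplings \<nu>1 \<nu>2 =
     {\<pi>. sets \<pi> = sets (borel \<Otimes>\<^sub>M borel) \<and> distr \<pi> borel fst = \<nu>1 \<and> distr \<pi> borel snd = \<nu>2}"

text \<open>The value is extended: it may be \<open>\<infinity>\<close>.\<close>

definition wasserstein ::
  "('a::topological_space \<Rightarrow> 'a \<Rightarrow> real) \<Rightarrow> 'a measure \<Rightarrow> 'a measure \<Rightarrow> ennreal" where
  "wasserstein d \<nu>1 \<nu>2 =
     (INF \<pi>\<in>couplings \<nu>1 \<nu>2. \<integral>\<^sup>+z. ennreal (d (fst z) (snd z)) \<partial>\<pi>)"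

definition d_eps :: "real \<Rightarrow> 'a::real_normed_vector \<Rightarrow> 'a \<Rightarrow> real" where
  "d_eps \<epsilon> x y = min 1 (norm (x - y) / \<epsilon>)"

definition d_tilde ::
  "('a::real_normed_vector \<Rightarrow> real) \<Rightarrow> real \<Rightarrow> 'a \<Rightarrow> 'a \<Rightarrow> real" where
  "d_tilde V \<epsilon> x y = sqrt (d_eps \<epsilon> x y * (1 + V x + V y))"

text \<open>The power \<open>k\<close> is positive: for \<open>k = 0\<close> the function is constant and the contraction
  result fails (already for \<open>\<Phi> = 0\<close>, \<open>0 < \<rho>\<close>, if the space is not \<open>{0}\<close>), since states far from the origin take
  arbitrarily long to return. \<open>v0\<close> is the bound below which \<open>v\<close> counts as small in the
  squared-exponential case.\<close>

definition admissible_V :: "real \<Rightarrow> ('a::real_normed_vector \<Rightarrow> real) \<Rightarrow> bool" where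
  "admissible_V v0 V \<longleftrightarrow>
     (\<exists>k::nat. 1 \<le> k \<and> V = (\<lambda>x. norm x ^ k)) \<or>
     (\<exists>v>0. V = (\<lambda>x. exp (v * norm x))) \<or>
     (\<exists>v. 0 < v \<and> v \<le> v0 \<and> V = (\<lambda>x. exp (v * (norm x)\<^sup>2)))"

end

theory Submission
  imports Defs
begin

text \<open>
  Write \<open>\<gamma> = Q 0\<close>. A Gaussian measure on a separable Hilbert space is determined by its
  one-dimensional projections (\<open>fourier_uniqueness\<close>), so \<open>Q x\<close> is the law of \<open>\<rho> x + \<xi>\<close> with
  \<open>\<xi> \<sim> \<gamma>\<close>, and one step of the chain either moves \<open>x\<close> to \<open>\<rho> x + \<xi>\<close>, with a density
  \<open>move_density x \<xi>\<close> with respect to \<open>\<gamma>\<close>, or leaves \<open>x\<close> where it is. Since \<open>\<bar>\<Phi>\<bar> \<le> M\<close>, this density is at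
  least \<open>exp (- 2 M)\<close> everywhere, and since \<open>\<Phi>\<close> is Lipschitz, the densities at \<open>x\<close> and \<open>y\<close> differ by
  a factor of at most \<open>exp (2 L \<parallel>x - y\<parallel>)\<close>.

  Two copies of the chain are therefore coupled as follows: as much mass as possible is spent on
  taking the same decision with the same \<open>\<xi>\<close>, and the rest is coupled independently. A common move
  has probability at least \<open>exp (- 2 M)\<close> and shrinks the distance by the factor \<open>\<rho>\<close>, a common
  rejection preserves it, and the decisions differ with probability at most
  \<open>min 1 (2 L \<parallel>x - y\<parallel>)\<close>. For the bounded concave function \<open>1 - (1 + r/\<eta>)\<^sup>-\<^sup>q\<close> of the distance \<open>r\<close>,
  with \<open>q\<close> large and \<open>\<eta>\<close> small, the gain from the common moves dominates the loss from the differing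
  decisions at every distance, with a relative gain that is bounded below on bounded sets
  (\<open>saturating_contraction\<close>, \<open>overlap_bound\<close>). This one function takes the place of the two
  conditions of the weak Harris theorem, contraction at small distances and smallness of the
  sublevel sets of \<open>V\<close>, and makes a single step sufficient.

  Each \<open>V\<close> is a convex increasing function of the norm, whence
  \<open>V (\<rho> x + \<xi>) \<le> \<rho> V x + (1 - \<rho>) V (\<xi> / (1 - \<rho>))\<close>; the last term is integrable by Fernique's theorem
  (\<open>fernique\<close>), and this is what bounds \<open>v\<close> in the squared-exponential case. So \<open>V\<close> is a Lyapunov
  function. The argument of Hairer, Mattingly and Scheutzow then combines the two ingredients by
  the Cauchy-Schwarz inequality (\<open>weak_harris_step\<close>): \<open>sqrt (f (1 + \<beta> V + \<beta> V))\<close>, with \<open>f\<close> the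
  saturating distance and \<open>\<beta>\<close> small, contracts by a fixed factor in every step. For every \<open>\<epsilon>\<close> this
  distance is equivalent to \<open>d_tilde V \<epsilon>\<close>, and the constants of the equivalence are absorbed by a
  slightly slower rate and a starting time \<open>n1\<close>.
\<close>

section \<open>Uniqueness of measures with a given Fourier transform\<close>

text \<open>Closed balls are countable intersections of half-spaces, because the norm is a supremum of
  linear functionals that may be taken from a countable dense set.\<close>

lemma open_in_sigma_halfspaces:
  fixes S :: "'a::{real_inner, second_countable_topology} set"
  assumes "open S"
  shows "S \<in> sigma_sets UNIV {{x. \<forall>(k, a)\<in>T. a < x \<bullet> k} | T :: ('a \<times> real) set. finite T}"
    (is "_ \<in> sigma_sets UNIV ?E")
proof -
  let ?N = "sigma UNIV ?E"
  have [measurable]: "(\<lambda>x. x \<bullet> k) \<in> borel_measurable ?N" for k :: 'a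
    unfolding borel_measurable_iff_greater
  proof
    fix a
    have "{x. a < x \<bullet> k} \<in> ?E"
      by (intro CollectI exI[of _ "{(k, a)}"]) auto
    then show "{x \<in> space ?N. a < x \<bullet> k} \<in> sets ?N"
      by auto
  qed
  obtain D :: "'a set" where D: "countable D" "\<And>X. open X \<Longrightarrow> X \<noteq> {} \<Longrightarrow> \<exists>d\<in>D. d \<in> X"
    using countable_dense_setE by metis
  have norm_le_iff: "norm (x - c) \<le> e \<longleftrightarrow> (\<forall>h\<in>D. x \<bullet> h - c \<bullet> h \<le> e * norm h)" if "0 \<le> e" for x c :: 'a and e
  proof
    assume "norm (x - c) \<le> e"
    then show "\<forall>h\<in>D. x \<bullet> h - c \<bullet> h \<le> e * norm h"
      by (metis inner_diff_left norm_cauchy_schwarz order_trans mult_right_mono norm_ge_zero)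
  next
    assume *: "\<forall>h\<in>D. x \<bullet> h - c \<bullet> h \<le> e * norm h"
    have "open {h. e * norm h < (x - c) \<bullet> h}"
      by (intro open_Collect_less continuous_intros)
    moreover have "\<not> (\<exists>h\<in>D. h \<in> {h. e * norm h < (x - c) \<bullet> h})"
      using * by (auto simp: inner_diff_left not_less)
    ultimately have "{h. e * norm h < (x - c) \<bullet> h} = {}"
      using D(2) by blast
    then have "(x - c) \<bullet> (x - c) \<le> e * norm (x - c)"
      by (auto simp: not_less)
    then have "norm (x - c) * norm (x - c) \<le> e * norm (x - c)"
      by (metis power2_eq_square power2_norm_eq_inner)
    then show "norm (x - c) \<le> e"
      using that by (cases "norm (x - c) = 0") (auto simp: mult_le_cancel_right)
  qed
  have cball: "cball c e \<in> sets ?N" if "0 \<le> e" for c :: 'a and e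
  proof -
    have "cball c e = {x \<in> space ?N. \<forall>h\<in>D. x \<bullet> h - c \<bullet> h \<le> e * norm h}"
      using norm_le_iff[OF that] by (auto simp: dist_norm norm_minus_commute)
    also have "\<dots> \<in> sets ?N"
      using D(1) by measurable
    finally show ?thesis .
  qed
  let ?I = "{(d, q :: rat). d \<in> D \<and> 0 < q \<and> cball d (of_rat q) \<subseteq> S}"
  have "S \<subseteq> (\<Union>(d, q)\<in>?I. cball d (of_rat q))"
  proof
    fix x assume "x \<in> S"
    then obtain r where r: "0 < r" "ball x r \<subseteq> S"
      using assms openE by blast
    obtain q :: rat where q: "0 < real_of_rat q" "of_rat q < r / 2"
      using of_rat_dense[of 0 "r/2"] r(1) by auto
    obtain d where d: "d \<in> D" "d \<in> ball x (of_rat q)"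
      using D(2)[of "ball x (of_rat q)"] q(1) by auto
    have "cball d (of_rat q) \<subseteq> S"
    proof
      fix y assume "y \<in> cball d (of_rat q)"
      then have "dist x y < r"
        using d(2) q(2) dist_triangle[of x y d] by auto
      then show "y \<in> S" using r(2) by auto
    qed
    then show "x \<in> (\<Union>(d, q)\<in>?I. cball d (of_rat q))"
      using d q(1) by (intro UN_I[of "(d, q)"]) (simp_all add: dist_commute less_imp_le)
  qed
  moreover have "(\<Union>(d, q)\<in>?I. cball d (of_rat q)) \<subseteq> S"
    by (rule UN_least) (clarsimp simp: subset_iff)
  ultimately have "S = (\<Union>(d, q)\<in>?I. cball d (of_rat q))"
    by (rule subset_antisym)
  also have "\<dots> \<in> sets ?N"
  proof (rule sets.countable_UN'')
    have "?I \<subseteq> D \<times> UNIV" by auto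
    then show "countable ?I"
      by (rule countable_subset) (intro countable_SIGMA D(1) countableI_type)
  next
    fix p assume "p \<in> ?I"
    then show "(case p of (d, q) \<Rightarrow> cball d (of_rat q)) \<in> sets ?N"
      using cball by (cases p) (auto simp del: sets_measure_of)
  qed
  finally show ?thesis
    by simp
qed


text \<open>A transfer of the one-dimensional uniqueness theorem of Levy: \<open>u\<close> is normalised to a
  probability density, and the law of \<open>x \<bullet> k\<close> under it is considered.\<close>

lemma halfspace_integral_eqI:
  fixes M N :: "'a::{real_inner, second_countable_topology} measure" and u :: "'a \<Rightarrow> real"
  assumes M: "prob_space M" "sets M = sets borel" and N: "prob_space N" "sets N = sets borel"
    and u[measurable]: "u \<in> borel_measurable borel" and uB: "\<And>x. 0 \<le> u x" "\<And>x. u x \<le> B"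
    and cos_eq: "\<And>t. (\<integral>x. u x * cos (t * (x \<bullet> k)) \<partial>M) = (\<integral>x. u x * cos (t * (x \<bullet> k)) \<partial>N)"
    and sin_eq: "\<And>t. (\<integral>x. u x * sin (t * (x \<bullet> k)) \<partial>M) = (\<integral>x. u x * sin (t * (x \<bullet> k)) \<partial>N)"
  shows "(\<integral>x. u x * indicator {x. a < x \<bullet> k} x \<partial>M) = (\<integral>x. u x * indicator {x. a < x \<bullet> k} x \<partial>N)"
proof -
  define c where "c = (\<integral>x. u x \<partial>M)"
  have cN: "(\<integral>x. u x \<partial>N) = c"
    using cos_eq[of 0] by (simp add: c_def)
  have int_u: "integrable K u" if "prob_space K" "sets K = sets borel" for K :: "'a measure"
  proof -
    interpret K: prob_space K by fact
    have [measurable_cong]: "sets K = sets borel" by fact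
    show ?thesis
      by (rule K.integrable_const_bound[of _ B]) (use uB in auto)
  qed
  show ?thesis
  proof (cases "c = 0")
    case True
    have "(\<integral>x. u x * indicator {x. a < x \<bullet> k} x \<partial>K) = 0"
      if K: "prob_space K" "sets K = sets borel" "(\<integral>x. u x \<partial>K) = 0" for K :: "'a measure"
    proof -
      have "AE x in K. u x = 0"
        using integral_nonneg_eq_0_iff_AE[OF int_u[OF K(1,2)]] uB K(3) by auto
      then have "AE x in K. u x * indicator {x. a < x \<bullet> k} x = 0"
        by auto
      then show ?thesis
        by (rule integral_eq_zero_AE)
    qed
    with True M N cN show ?thesis by (simp add: c_def)
  next
    case False
    then have "0 < c"
      using uB by (auto simp: c_def less_le intro: integral_nonneg)
    define push where "push K = distr (density K (\<lambda>x. ennreal (u x / c))) borel (\<lambda>x. x \<bullet> k)" for K :: "'a measure"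
    have push: "real_distribution (push K)"
      "char (push K) t = Complex ((\<integral>x. u x * cos (t * (x \<bullet> k)) \<partial>K) / c) ((\<integral>x. u x * sin (t * (x \<bullet> k)) \<partial>K) / c)"
      "measure (push K) {a<..} = (\<integral>x. u x * indicator {x. a < x \<bullet> k} x \<partial>K) / c"
      if K: "prob_space K" "sets K = sets borel" "(\<integral>x. u x \<partial>K) = c" for K :: "'a measure" and t
    proof -
      interpret K: prob_space K by fact
      have [measurable_cong]: "sets K = sets borel" by fact
      note int_u[OF K(1,2), simp]
      have "(\<integral>\<^sup>+x. ennreal (u x / c) \<partial>K) = 1"
        using \<open>0 < c\<close> uB by (subst nn_integral_eq_integral) (auto simp: K(3))
      then have "prob_space (density K (\<lambda>x. ennreal (u x / c)))"
        by (intro prob_spaceI) (simp add: emeasure_density cong: nn_integral_cong)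
      then interpret D: prob_space "density K (\<lambda>x. ennreal (u x / c))" .
      show "real_distribution (push K)"
        unfolding push_def by (intro D.real_distribution_distr) simp
      have bdd: "integrable K (\<lambda>x. (u x / c) *\<^sub>R iexp (t * (x \<bullet> k)))"
        by (rule K.integrable_const_bound[of _ "B / c"]) (use uB \<open>0 < c\<close> in \<open>auto simp: norm_mult divide_right_mono\<close>)
      have "char (push K) t = (\<integral>x. (u x / c) *\<^sub>R iexp (t * (x \<bullet> k)) \<partial>K)"
        unfolding char_def push_def
        by (subst integral_distr, simp, simp, subst integral_density) (use uB \<open>0 < c\<close> in auto)
      also have "\<dots> = Complex ((\<integral>x. u x * cos (t * (x \<bullet> k)) \<partial>K) / c) ((\<integral>x. u x * sin (t * (x \<bullet> k)) \<partial>K) / c)"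
        by (rule complex_eqI; subst integral_Re[OF bdd, symmetric] integral_Im[OF bdd, symmetric])
           (simp_all add: Re_exp Im_exp)
      finally show "char (push K) t = Complex ((\<integral>x. u x * cos (t * (x \<bullet> k)) \<partial>K) / c) ((\<integral>x. u x * sin (t * (x \<bullet> k)) \<partial>K) / c)" .
      have "measure (push K) {a<..} = (\<integral>x. indicator {a<..} x \<partial>push K)"
        by (simp add: push_def)
      also have "\<dots> = (\<integral>x. (u x / c) *\<^sub>R indicator {a<..} (x \<bullet> k) \<partial>K)"
        unfolding push_def
        by (subst integral_distr, simp, simp, subst integral_density) (use uB \<open>0 < c\<close> in auto)
      also have "\<dots> = (\<integral>x. u x * indicator {x. a < x \<bullet> k} x / c \<partial>K)"
        by (intro Bochner_Integration.integral_cong) (auto simp: indicator_def)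
      finally show "measure (push K) {a<..} = (\<integral>x. u x * indicator {x. a < x \<bullet> k} x \<partial>K) / c"
        by simp
    qed
    have "push M = push N"
      by (rule Levy_uniqueness) (use M N cN push cos_eq sin_eq in \<open>auto simp: c_def fun_eq_iff\<close>)
    with push(3)[OF M c_def[symmetric]] push(3)[OF N cN] \<open>0 < c\<close> show ?thesis
      by simp
  qed
qed

text \<open>A half-space \<open>{x. a < x \<bullet> k}\<close> can be inserted under the Fourier transform: the weights
  \<open>2 + cos (x \<bullet> h)\<close> and \<open>2 + sin (x \<bullet> h)\<close> are positive, and the law of \<open>x \<bullet> k\<close> under such a weight
  has a characteristic function that the product formulas of trigonometry express by the given
  transform at \<open>h \<plusminus> t k\<close>.\<close>

lemma fourier_eq_restrict_halfspace:
  fixes M N :: "'a::{real_inner, second_countable_topology} measure" and w :: "'a \<Rightarrow> real"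
  assumes M: "prob_space M" "sets M = sets borel" and N: "prob_space N" "sets N = sets borel"
    and w[measurable]: "w \<in> borel_measurable borel" and w01: "\<And>x. 0 \<le> w x" "\<And>x. w x \<le> 1"
    and c: "\<And>h. (\<integral>x. w x * cos (x \<bullet> h) \<partial>M) = (\<integral>x. w x * cos (x \<bullet> h) \<partial>N)"
    and s: "\<And>h. (\<integral>x. w x * sin (x \<bullet> h) \<partial>M) = (\<integral>x. w x * sin (x \<bullet> h) \<partial>N)"
  shows "(\<integral>x. (w x * indicator {x. a < x \<bullet> k} x) * cos (x \<bullet> h) \<partial>M) = (\<integral>x. (w x * indicator {x. a < x \<bullet> k} x) * cos (x \<bullet> h) \<partial>N)"
      (is ?cos)
    and "(\<integral>x. (w x * indicator {x. a < x \<bullet> k} x) * sin (x \<bullet> h) \<partial>M) = (\<integral>x. (w x * indicator {x. a < x \<bullet> k} x) * sin (x \<bullet> h) \<partial>N)"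
      (is ?sin)
proof -
  let ?H = "{x. a < x \<bullet> k}"
  have int_cos: "integrable K (\<lambda>x. w x * cos (x \<bullet> g))" and int_sin: "integrable K (\<lambda>x. w x * sin (x \<bullet> g))"
    and int_cosH: "integrable K (\<lambda>x. (w x * indicator ?H x) * cos (x \<bullet> g))" and int_sinH: "integrable K (\<lambda>x. (w x * indicator ?H x) * sin (x \<bullet> g))"
    and int_H: "integrable K (\<lambda>x. w x * indicator ?H x)"
    if "prob_space K" "sets K = sets borel" for K :: "'a measure" and g
  proof -
    interpret K: prob_space K by fact
    have [measurable_cong]: "sets K = sets borel" by fact
    have bounded: "integrable K f" if [measurable]: "f \<in> borel_measurable borel" and "\<And>x. \<bar>f x\<bar> \<le> 1" for f :: "'a \<Rightarrow> real"
      using that(2) by (intro K.integrable_const_bound[of _ 1]) simp_all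
    have *: "w x * \<bar>r\<bar> \<le> 1" if "\<bar>r\<bar> \<le> 1" for x r
      using mult_mono[of "w x" 1 "\<bar>r\<bar>" 1] w01[of x] that by auto
    show "integrable K (\<lambda>x. w x * cos (x \<bullet> g))" "integrable K (\<lambda>x. w x * sin (x \<bullet> g))"
      "integrable K (\<lambda>x. (w x * indicator ?H x) * cos (x \<bullet> g))" "integrable K (\<lambda>x. (w x * indicator ?H x) * sin (x \<bullet> g))"
      "integrable K (\<lambda>x. w x * indicator ?H x)"
      by (rule bounded; simp add: abs_mult w01 * indicator_def)+
  qed
  note ints = int_cos[OF M] int_sin[OF M] int_cos[OF N] int_sin[OF N]
  note intsH = int_cosH[OF M] int_sinH[OF M] int_cosH[OF N] int_sinH[OF N] int_H[OF M] int_H[OF N]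
  have *: "w x * (2 + cos (x \<bullet> h)) * cos (t * (x \<bullet> k)) =
      2 * (w x * cos (x \<bullet> (t *\<^sub>R k))) + (w x * cos (x \<bullet> (t *\<^sub>R k - h)) + w x * cos (x \<bullet> (t *\<^sub>R k + h))) / 2"
    "w x * (2 + cos (x \<bullet> h)) * sin (t * (x \<bullet> k)) =
      2 * (w x * sin (x \<bullet> (t *\<^sub>R k))) + (w x * sin (x \<bullet> (t *\<^sub>R k - h)) + w x * sin (x \<bullet> (t *\<^sub>R k + h))) / 2"
    "w x * (2 + sin (x \<bullet> h)) * cos (t * (x \<bullet> k)) =
      2 * (w x * cos (x \<bullet> (t *\<^sub>R k))) + (w x * sin (x \<bullet> (t *\<^sub>R k + h)) - w x * sin (x \<bullet> (t *\<^sub>R k - h))) / 2"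
    "w x * (2 + sin (x \<bullet> h)) * sin (t * (x \<bullet> k)) =
      2 * (w x * sin (x \<bullet> (t *\<^sub>R k))) + (w x * cos (x \<bullet> (t *\<^sub>R k - h)) - w x * cos (x \<bullet> (t *\<^sub>R k + h))) / 2" for x t h
    by (simp_all add: inner_add_right inner_diff_right cos_add cos_diff sin_add sin_diff algebra_simps)
  have w_bounds: "0 \<le> w x * (2 + r)" "w x * (2 + r) \<le> 3" if "\<bar>r\<bar> \<le> 1" for x r
    using w01[of x] that mult_mono[of "w x" 1 "2 + r" 3] by auto
  have main_cos: "(\<integral>x. w x * (2 + cos (x \<bullet> h)) * indicator ?H x \<partial>M) = (\<integral>x. w x * (2 + cos (x \<bullet> h)) * indicator ?H x \<partial>N)" for h
    by (rule halfspace_integral_eqI[OF M N, where B=3]) (simp_all add: w_bounds * ints c s del: inner_scaleR_right)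
  have main_sin: "(\<integral>x. w x * (2 + sin (x \<bullet> h)) * indicator ?H x \<partial>M) = (\<integral>x. w x * (2 + sin (x \<bullet> h)) * indicator ?H x \<partial>N)" for h
    by (rule halfspace_integral_eqI[OF M N, where B=3]) (simp_all add: w_bounds * ints c s del: inner_scaleR_right)
  have *: "(\<lambda>x. w x * (2 + cos (x \<bullet> h)) * indicator ?H x) = (\<lambda>x. 2 * (w x * indicator ?H x) + (w x * indicator ?H x) * cos (x \<bullet> h))"
     "(\<lambda>x. w x * (2 + sin (x \<bullet> h)) * indicator ?H x) = (\<lambda>x. 2 * (w x * indicator ?H x) + (w x * indicator ?H x) * sin (x \<bullet> h))" for h
    by (auto simp: algebra_simps)
  have "(\<integral>x. w x * indicator ?H x \<partial>M) = (\<integral>x. w x * indicator ?H x \<partial>N)"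
    using main_sin[of 0] intsH unfolding * by simp
  with main_cos[of h] main_sin[of h] intsH show ?cos ?sin
    unfolding * by simp_all
qed

text \<open>Half-spaces are inserted under the Fourier transform one after the other; at \<open>h = 0\<close> the result
  says that both measures agree on finite intersections of half-spaces.\<close>

theorem fourier_uniqueness:
  fixes M N :: "'a::{real_inner, second_countable_topology} measure"
  assumes M: "prob_space M" "sets M = sets borel" and N: "prob_space N" "sets N = sets borel"
    and eq: "\<And>h. (\<integral>x. iexp (x \<bullet> h) \<partial>M) = (\<integral>x. iexp (x \<bullet> h) \<partial>N)"
  shows "M = N"
proof -
  let ?H = "\<lambda>T::('a \<times> real) set. {x. \<forall>(k, a)\<in>T. a < x \<bullet> k}"
  have [measurable_cong]: "sets M = sets borel" "sets N = sets borel" by fact+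
  have [measurable]: "?H T \<in> sets borel" if "finite T" for T
  proof -
    have "?H T = (\<Inter>(k, a)\<in>T. {x \<in> space borel. a < x \<bullet> k})" by auto
    also have "\<dots> \<in> sets borel"
      using that by (cases "T = {}") (auto intro!: sets.finite_INT)
    finally show ?thesis .
  qed
  interpret M: prob_space M by fact
  interpret N: prob_space N by fact
  have integrable_iexp: "integrable K (\<lambda>x. iexp (x \<bullet> h))" if "prob_space K" "sets K = sets borel" for K :: "'a measure" and h
  proof -
    interpret K: prob_space K by fact
    have [measurable_cong]: "sets K = sets borel" by fact
    show ?thesis by (rule K.integrable_const_bound[of _ 1]) auto
  qed
  have "(\<forall>h. (\<integral>x. indicator (?H T) x * cos (x \<bullet> h) \<partial>M) = (\<integral>x. indicator (?H T) x * cos (x \<bullet> h) \<partial>N)) \<and>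
        (\<forall>h. (\<integral>x. indicator (?H T) x * sin (x \<bullet> h) \<partial>M) = (\<integral>x. indicator (?H T) x * sin (x \<bullet> h) \<partial>N))"
    if "finite T" for T
    using that
  proof induction
    case empty
    have "(\<integral>x. cos (x \<bullet> h) \<partial>K) = Re (\<integral>x. iexp (x \<bullet> h) \<partial>K)" "(\<integral>x. sin (x \<bullet> h) \<partial>K) = Im (\<integral>x. iexp (x \<bullet> h) \<partial>K)"
      if "prob_space K" "sets K = sets borel" for K :: "'a measure" and h
      unfolding integral_Re[OF integrable_iexp[OF that], symmetric] integral_Im[OF integrable_iexp[OF that], symmetric]
      by (simp_all add: Re_exp Im_exp)
    with M N eq show ?case by simp
  next
    case (insert p T)
    obtain k a where p: "p = (k, a)" by force
    have "indicator (?H (insert p T)) = (\<lambda>x. indicator (?H T) x * indicator {x. a < x \<bullet> k} x :: real)"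
      by (auto simp: p indicator_def)
    then show ?case
      using fourier_eq_restrict_halfspace[OF M N, of "indicator (?H T)" a k] insert by simp
  qed
  note fourier_eq = this
  have *: "measure M (?H T) = measure N (?H T)" if "finite T" for T
    using fourier_eq[OF that, THEN conjunct1, THEN spec, of 0] that
    by (simp add: M(2) N(2) sets_eq_imp_space_eq)
  \<comment> \<open>finite intersections of half-spaces form a generating system stable under intersection\<close>
  let ?E = "{?H T | T. finite T}"
  show ?thesis
  proof (rule measure_eqI_generator_eq[where E="?E" and \<Omega>=UNIV and A="\<lambda>_. UNIV"])
    show "Int_stable ?E"
    proof (rule Int_stableI)
      fix A B assume "A \<in> ?E" "B \<in> ?E"
      then obtain S T where "finite S" "A = ?H S" "finite T" "B = ?H T" by blast
      then show "A \<inter> B \<in> ?E"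
        by (intro CollectI exI[of _ "S \<union> T"]) auto
    qed
    show "emeasure M X = emeasure N X" if "X \<in> ?E" for X
      using that * by (auto simp: M.emeasure_eq_measure N.emeasure_eq_measure)
    have "sets borel = sigma_sets UNIV ?E"
    proof
      show "sets borel \<subseteq> sigma_sets UNIV ?E"
        unfolding borel_def using open_in_sigma_halfspaces
        by (auto intro!: sigma_sets_mono simp: sets_measure_of_conv)
      show "sigma_sets UNIV ?E \<subseteq> sets borel"
        by (rule sets.sigma_sets_subset[of ?E borel, simplified]) auto
    qed
    then show "sets M = sigma_sets UNIV ?E" "sets N = sigma_sets UNIV ?E"
      using M N by auto
    show "range (\<lambda>_::nat. UNIV) \<subseteq> ?E"
      by (auto intro!: exI[of _ "{}"])
  qed auto
qed

section \<open>Gaussian measures and Fernique's theorem\<close>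

lemma integral_iexp_real_gaussian:
  assumes "0 \<le> v"
  shows "(\<integral>t. iexp t \<partial>real_gaussian m v) = iexp m * exp (- v / 2)"
proof (cases "v = 0")
  case True
  then show ?thesis by (simp add: real_gaussian_def integral_return)
next
  case False
  define \<sigma> where "\<sigma> = sqrt v"
  have \<sigma>: "0 < \<sigma>" "\<sigma>\<^sup>2 = v" using False assms by (auto simp: \<sigma>_def)
  have dens: "\<sigma> * normal_density m \<sigma> (m + \<sigma> * s) = std_normal_density s" for s
    using \<sigma>(1) by (simp add: normal_density_def real_sqrt_mult power_mult_distrib)
  have "(\<integral>t. iexp t \<partial>real_gaussian m v) = (\<integral>t. normal_density m \<sigma> t *\<^sub>R iexp t \<partial>lborel)"
    using False by (simp add: real_gaussian_def \<sigma>_def[symmetric] integral_density)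
  also have "\<dots> = \<sigma> *\<^sub>R (\<integral>s. normal_density m \<sigma> (m + \<sigma> * s) *\<^sub>R iexp (m + \<sigma> * s) \<partial>lborel)"
    using \<sigma>(1) by (subst lborel_integral_real_affine[where c=\<sigma> and t=m]) auto
  also have "\<dots> = (\<integral>s. \<sigma> *\<^sub>R (normal_density m \<sigma> (m + \<sigma> * s) *\<^sub>R iexp (m + \<sigma> * s)) \<partial>lborel)"
    by (rule integral_scaleR_right[symmetric])
  also have "\<dots> = (\<integral>s. iexp m * (std_normal_density s *\<^sub>R iexp (\<sigma> * s)) \<partial>lborel)"
    by (intro Bochner_Integration.integral_cong refl)
       (simp add: dens[symmetric] exp_add distrib_left scaleR_conv_of_real mult_ac)
  also have "\<dots> = iexp m * char std_normal_distribution \<sigma>"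
    by (simp only: integral_mult_right_zero char_def) (simp add: integral_density)
  also have "\<dots> = iexp m * exp (- v / 2)"
    by (simp add: char_std_normal_distribution \<sigma>(2) exp_of_real[symmetric] of_real_power[symmetric] del: of_real_power)
  finally show ?thesis by simp
qed

lemma gaussian_fourier:
  fixes M :: "'a::{real_inner, second_countable_topology} measure"
  assumes M: "is_gaussian_measure M m K" and "0 \<le> K h \<bullet> h"
  shows "(\<integral>x. iexp (x \<bullet> h) \<partial>M) = iexp (m \<bullet> h) * exp (- (K h \<bullet> h) / 2)"
proof -
  have [measurable_cong]: "sets M = sets borel" using M by (simp add: is_gaussian_measure_def)
  have "(\<integral>x. iexp (x \<bullet> h) \<partial>M) = (\<integral>t. iexp t \<partial>distr M borel (\<lambda>x. x \<bullet> h))"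
    by (subst integral_distr) auto
  also have "\<dots> = iexp (m \<bullet> h) * exp (- (K h \<bullet> h) / 2)"
    using M assms(2) by (simp add: is_gaussian_measure_def integral_iexp_real_gaussian)
  finally show ?thesis .
qed

text \<open>The same noise drives the Gaussian proposal from every state, which is what allows proposals
  from different states to be coupled.\<close>

lemma gaussian_translate:
  fixes Q :: "'a::{real_inner, second_countable_topology} \<Rightarrow> 'a measure"
  assumes Q: "\<And>x. is_gaussian_measure (Q x) (m x) K" and K: "\<And>h. 0 \<le> K h \<bullet> h" and "m z = 0"
  shows "Q x = distr (Q z) borel (\<lambda>\<xi>. m x + \<xi>)"
proof -
  have Qx: "prob_space (Q x)" "sets (Q x) = sets borel" for x
    using Q by (auto simp: is_gaussian_measure_def)
  note [measurable_cong] = Qx(2)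
  interpret prob_space "Q z" by fact
  show ?thesis
  proof (rule fourier_uniqueness)
    show "prob_space (distr (Q z) borel (\<lambda>\<xi>. m x + \<xi>))"
      by (intro prob_space_distr) simp
    show "(\<integral>y. iexp (y \<bullet> h) \<partial>Q x) = (\<integral>y. iexp (y \<bullet> h) \<partial>distr (Q z) borel (\<lambda>\<xi>. m x + \<xi>))" for h
      by (subst integral_distr)
         (simp_all add: gaussian_fourier[OF Q K] inner_add_left distrib_left exp_add \<open>m z = 0\<close>)
  qed (use Qx in auto)
qed

text \<open>The variance enters only as a quadratic form \<open>v\<close>; the parallelogram law and homogeneity are
  what makes the rotation argument below work.\<close>

locale centered_gaussian = prob_space \<gamma>
  for \<gamma> :: "'a::{real_inner, second_countable_topology} measure" and v :: "'a \<Rightarrow> real" +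
  assumes sets_\<gamma>[measurable_cong, simp]: "sets \<gamma> = sets borel"
    and fourier: "(\<integral>x. iexp (x \<bullet> h) \<partial>\<gamma>) = of_real (exp (- v h / 2))"
    and v_parallelogram: "v (h + k) + v (h - k) = 2 * v h + 2 * v k"
    and v_scale: "v (c *\<^sub>R h) = c\<^sup>2 * v h"
begin

sublocale pair: pair_prob_space \<gamma> \<gamma> ..

lemma space_\<gamma>[simp]: "space \<gamma> = UNIV"
  using sets_\<gamma>[THEN sets_eq_imp_space_eq] by simp

lemma fourier_pair: "(\<integral>(x, y). iexp (x \<bullet> h + y \<bullet> k) \<partial>(\<gamma> \<Otimes>\<^sub>M \<gamma>)) = of_real (exp (- (v h + v k) / 2))"
proof -
  have "integrable (\<gamma> \<Otimes>\<^sub>M \<gamma>) (\<lambda>(x, y). iexp (x \<bullet> h + y \<bullet> k))"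
    by (rule pair.P.integrable_const_bound[of _ 1]) auto
  from pair.integral_fst'[OF this]
  have "(\<integral>(x, y). iexp (x \<bullet> h + y \<bullet> k) \<partial>(\<gamma> \<Otimes>\<^sub>M \<gamma>)) = (\<integral>x. (\<integral>y. iexp (x \<bullet> h) * iexp (y \<bullet> k) \<partial>\<gamma>) \<partial>\<gamma>)"
    by (simp add: distrib_left exp_add)
  also have "\<dots> = of_real (exp (- v h / 2)) * of_real (exp (- v k / 2))"
    by (simp only: integral_mult_right_zero integral_mult_left_zero fourier)
  also have "\<dots> = of_real (exp (- v h / 2) * exp (- v k / 2))"
    by (rule of_real_mult[symmetric])
  also have "exp (- v h / 2) * exp (- v k / 2) = exp (- (v h + v k) / 2)"
    by (simp add: exp_add[symmetric] add_divide_distrib)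
  finally show ?thesis .
qed

text \<open>Rotation by 45 degrees preserves the law of two independent copies, because the variance
  \<open>v\<close> satisfies the parallelogram law.\<close>

lemma rotation_invariant:
  "distr (\<gamma> \<Otimes>\<^sub>M \<gamma>) borel (\<lambda>(x, y). ((1 / sqrt 2) *\<^sub>R (x + y), (1 / sqrt 2) *\<^sub>R (x - y))) = \<gamma> \<Otimes>\<^sub>M \<gamma>"
    (is "distr _ _ ?R = _")
proof (rule fourier_uniqueness)
  have sets_pair: "sets (\<gamma> \<Otimes>\<^sub>M \<gamma>) = sets (borel \<Otimes>\<^sub>M borel)"
    by (intro sets_pair_measure_cong) simp_all
  then show "sets (\<gamma> \<Otimes>\<^sub>M \<gamma>) = sets borel"
    unfolding borel_prod .
  have [measurable]: "?R \<in> (\<gamma> \<Otimes>\<^sub>M \<gamma>) \<rightarrow>\<^sub>M borel"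
    unfolding borel_prod[symmetric] by measurable
  show "prob_space (distr (\<gamma> \<Otimes>\<^sub>M \<gamma>) borel ?R)"
    by (rule pair.P.prob_space_distr) simp
  show "prob_space (\<gamma> \<Otimes>\<^sub>M \<gamma>)"
    by (rule pair.P.prob_space_axioms)
  fix h :: "'a \<times> 'a"
  obtain a b where h: "h = (a, b)" by force
  let ?s = "1 / sqrt 2"
  have *: "?R p \<bullet> h = fst p \<bullet> (?s *\<^sub>R (a + b)) + snd p \<bullet> (?s *\<^sub>R (a - b))" for p
    by (cases p) (simp add: h algebra_simps inner_add_right inner_diff_right inner_add_left inner_diff_left)
  have var: "v (?s *\<^sub>R (a + b)) + v (?s *\<^sub>R (a - b)) = v a + v b"
    using v_parallelogram[of a b] by (simp only: v_scale) (simp add: power_divide)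
  have "(\<integral>p. iexp (p \<bullet> h) \<partial>distr (\<gamma> \<Otimes>\<^sub>M \<gamma>) borel ?R) = (\<integral>p. iexp (?R p \<bullet> h) \<partial>(\<gamma> \<Otimes>\<^sub>M \<gamma>))"
    by (rule integral_distr) measurable
  also have "\<dots> = of_real (exp (- (v a + v b) / 2))"
    using fourier_pair[of "?s *\<^sub>R (a + b)" "?s *\<^sub>R (a - b)"]
    unfolding * var by (simp add: case_prod_beta')
  also have "\<dots> = (\<integral>p. iexp (p \<bullet> h) \<partial>(\<gamma> \<Otimes>\<^sub>M \<gamma>))"
    using fourier_pair[of a b] by (simp add: h inner_prod_def case_prod_beta')
  finally show "(\<integral>p. iexp (p \<bullet> h) \<partial>distr (\<gamma> \<Otimes>\<^sub>M \<gamma>) borel ?R) = (\<integral>p. iexp (p \<bullet> h) \<partial>(\<gamma> \<Otimes>\<^sub>M \<gamma>))" .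
qed simp

definition tail :: "real \<Rightarrow> real" where
  "tail t = prob {x. t < norm x}"

lemma tail_antimono: "s \<le> t \<Longrightarrow> tail t \<le> tail s"
  unfolding tail_def by (intro finite_measure_mono) auto

text \<open>In the rotated coordinates the two independent events \<open>norm (x - y) / sqrt 2 \<le> s\<close> and
  \<open>t < norm (x + y) / sqrt 2\<close> force both \<open>x\<close> and \<open>y\<close> to be large.\<close>

lemma tail_square: "(1 - tail s) * tail t \<le> (tail ((t - s) / sqrt 2))\<^sup>2"
proof -
  let ?R = "\<lambda>(x, y). ((1 / sqrt 2) *\<^sub>R (x + y :: 'a), (1 / sqrt 2) *\<^sub>R (x - y))"
  let ?u = "(t - s) / sqrt 2"
  have [measurable]: "?R \<in> (\<gamma> \<Otimes>\<^sub>M \<gamma>) \<rightarrow>\<^sub>M borel"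
    unfolding borel_prod[symmetric] by measurable
  have times: "measure (\<gamma> \<Otimes>\<^sub>M \<gamma>) (A \<times> B) = prob A * prob B" if "A \<in> sets borel" "B \<in> sets borel" for A B
    using emeasure_pair_measure_Times[of A \<gamma> B] that
    by (simp add: pair.P.emeasure_eq_measure emeasure_eq_measure ennreal_mult[symmetric])
  have "prob {x. norm x \<le> s} = 1 - tail s"
  proof -
    have "{x. norm x \<le> s} = space \<gamma> - {x. s < norm x}" by auto
    then show ?thesis unfolding tail_def by (simp only:) (rule prob_compl, simp)
  qed
  then have "(1 - tail s) * tail t = measure (\<gamma> \<Otimes>\<^sub>M \<gamma>) ({x. t < norm x} \<times> {x. norm x \<le> s})"
    by (simp add: times tail_def mult.commute)
  also have "\<dots> = measure (distr (\<gamma> \<Otimes>\<^sub>M \<gamma>) borel ?R) ({x. t < norm x} \<times> {x. norm x \<le> s})"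
    by (simp only: rotation_invariant)
  also have "\<dots> = measure (\<gamma> \<Otimes>\<^sub>M \<gamma>) (?R -` ({x. t < norm x} \<times> {x. norm x \<le> s}) \<inter> space (\<gamma> \<Otimes>\<^sub>M \<gamma>))"
    by (rule measure_distr) (simp_all add: borel_prod[symmetric])
  also have "\<dots> \<le> measure (\<gamma> \<Otimes>\<^sub>M \<gamma>) ({x. ?u < norm x} \<times> {x. ?u < norm x})"
  proof (rule pair.P.finite_measure_mono)
    have "?u < norm x \<and> ?u < norm y" if "t < norm (x + y) / sqrt 2" "norm (x - y) / sqrt 2 \<le> s" for x y :: 'a
    proof -
      have *: "x - y + 2 *\<^sub>R y = x + y" "2 *\<^sub>R x - (x - y) = x + y"
        by (simp_all add: scaleR_2)
      have "norm (x + y) \<le> norm (x - y) + 2 * norm y" "norm (x + y) \<le> norm (x - y) + 2 * norm x"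
        using norm_triangle_ineq[of "x - y" "2 *\<^sub>R y"] norm_triangle_ineq4[of "2 *\<^sub>R x" "x - y"]
        unfolding * by simp_all
      moreover have "t * sqrt 2 < norm (x + y)" "norm (x - y) \<le> s * sqrt 2"
        using that by (simp_all add: field_simps)
      ultimately have "(t - s) * sqrt 2 < 2 * norm x" "(t - s) * sqrt 2 < 2 * norm y"
        by (auto simp: algebra_simps)
      moreover have "?u = (t - s) * sqrt 2 / 2"
        by (simp add: field_simps)
      ultimately show ?thesis by (simp only:) simp
    qed
    then show "?R -` ({x. t < norm x} \<times> {x. norm x \<le> s}) \<inter> space (\<gamma> \<Otimes>\<^sub>M \<gamma>) \<subseteq> {x. ?u < norm x} \<times> {x. ?u < norm x}"
      by auto
  qed (simp add: pair_measureI)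
  also have "\<dots> = (tail ?u)\<^sup>2"
    by (simp add: times tail_def power2_eq_square)
  finally show ?thesis .
qed

lemma small_tail: "\<exists>s>0. tail s \<le> 1 / 4"
proof -
  have "(\<lambda>n. prob {x. real n < norm x}) \<longlonglongrightarrow> prob (\<Inter>n. {x. real n < norm x})"
    by (rule finite_Lim_measure_decseq) (auto simp: decseq_def)
  moreover have "(\<Inter>n. {x::'a. real n < norm x}) = {}"
    using reals_Archimedean2[where 'a=real] by (auto intro!: Set.set_eqI) (meson less_asym)
  ultimately have "(\<lambda>n. tail (real n)) \<longlonglongrightarrow> 0"
    by (simp add: tail_def)
  then have "\<forall>\<^sub>F n in sequentially. tail (real n) < 1 / 4"
    by (rule order_tendstoD) simp
  then obtain n where "tail (real n) < 1 / 4"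
    by (auto simp: eventually_sequentially)
  moreover have "tail (real (Suc n)) \<le> tail (real n)"
    by (rule tail_antimono) simp
  ultimately show ?thesis
    by (intro exI[of _ "real (Suc n)"]) auto
qed

text \<open>Iterating \<open>tail_square\<close> at levels that grow like \<open>sqrt 2 ^ n\<close> squares the ratio
  \<open>tail t / (1 - tail s)\<close> every time, starting from \<open>1 / 3\<close>. The levels \<open>s (4 sqrt 2 ^ n - 3)\<close> dominate
  the exact recursion \<open>t \<mapsto> s + sqrt 2 t\<close>.\<close>

lemma tail_decay:
  assumes s: "0 < s" "tail s \<le> 1 / 4"
  shows "tail (s * (4 * sqrt 2 ^ n - 3)) \<le> (1 / 3) ^ (2 ^ n)"
proof -
  define p where "p = 1 - tail s"
  have p: "3 / 4 \<le> p" "p \<le> 1"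
    using s by (auto simp: p_def tail_def)
  have "tail (s * (4 * sqrt 2 ^ n - 3)) \<le> p * (1 / 3) ^ (2 ^ n)"
  proof (induction n)
    case 0
    then show ?case using s p by simp
  next
    case (Suc n)
    let ?t = "s * (4 * sqrt 2 ^ n - 3)"
    have "4 / 3 \<le> sqrt 2" by (rule real_le_rsqrt) (simp add: power2_eq_square)
    then have "s * 4 \<le> s * (3 * sqrt 2)"
      using s(1) by (intro mult_left_mono) auto
    then have "s + sqrt 2 * ?t \<le> s * (4 * sqrt 2 ^ Suc n - 3)"
      by (simp add: algebra_simps)
    then have "p * tail (s * (4 * sqrt 2 ^ Suc n - 3)) \<le> p * tail (s + sqrt 2 * ?t)"
      using p by (intro mult_left_mono tail_antimono) auto
    also have "\<dots> \<le> (tail ?t)\<^sup>2"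
      using tail_square[of s "s + sqrt 2 * ?t"] by (simp add: p_def)
    also have "\<dots> \<le> (p * (1 / 3) ^ (2 ^ n))\<^sup>2"
      using Suc by (intro power_mono) (auto simp: tail_def)
    also have "\<dots> = p * (p * (1 / 3) ^ (2 ^ Suc n))"
      by (simp add: power2_eq_square power_mult mult_ac power_even_eq power_mult_distrib[symmetric])
    finally show ?case using p by simp
  qed
  also have "\<dots> \<le> (1 / 3) ^ (2 ^ n)"
    using p by (simp add: mult_left_le_one_le)
  finally show ?thesis .
qed

text \<open>On the shell between consecutive levels the integrand is at most \<open>exp (2 ^ n)\<close>, against a tail of
  at most \<open>3 ^ (- 2 ^ n)\<close>, and \<open>exp 1 < 3\<close>.\<close>

theorem fernique: "\<exists>c>0. (\<integral>\<^sup>+x. ennreal (exp (c * (norm x)\<^sup>2)) \<partial>\<gamma>) < \<infinity>"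
proof -
  obtain s where s: "0 < s" "tail s \<le> 1 / 4"
    using small_tail by blast
  \<comment> \<open>chosen so that the exponent on the \<open>n\<close>-th shell is at most \<open>2 ^ n\<close>\<close>
  define c where "c = 1 / (32 * s\<^sup>2)"
  have "0 < c" using s by (simp add: c_def)
  define t where "t n = s * (4 * sqrt 2 ^ n - 3)" for n
  have one_le: "1 \<le> sqrt 2 ^ n" for n
    by (rule one_le_power) simp
  have t_pos: "0 < t n" for n
    unfolding t_def using s(1) one_le[of n] by (intro mult_pos_pos) linarith+
  have pow2: "(sqrt 2 ^ n)\<^sup>2 = (2::real) ^ n" for n
    using power_mult[of "sqrt 2" n 2] power_mult[of "sqrt 2" 2 n] by (simp add: mult.commute)
  have t_sq: "c * (t (Suc n))\<^sup>2 \<le> 2 ^ n" for n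
  proof -
    have "(t (Suc n))\<^sup>2 \<le> (s * (4 * sqrt 2 ^ Suc n))\<^sup>2"
      using s(1) t_pos[of "Suc n"] by (intro power_mono) (auto simp: t_def)
    also have "\<dots> = 32 * s\<^sup>2 * 2 ^ n"
      by (simp add: power_mult_distrib pow2)
    finally show ?thesis using s(1) by (simp add: c_def field_simps)
  qed
  have t_large: "\<exists>n. r \<le> t n" for r
  proof -
    obtain n where "r / s + 3 < sqrt 2 ^ n"
      using real_arch_pow[of "sqrt 2" "r / s + 3"] by auto
    then have "r / s \<le> 4 * sqrt 2 ^ n - 3"
      using one_le[of n] by linarith
    then show ?thesis
      using s(1) by (intro exI[of _ n]) (simp add: t_def field_simps)
  qed
  have pointwise: "ennreal (exp (c * (norm x)\<^sup>2)) \<le>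
      ennreal (exp (c * s\<^sup>2)) + (\<Sum>n. ennreal (exp (2 ^ n)) * indicator {x. t n < norm x} x)" for x
  proof (cases "norm x \<le> t 0")
    case True
    then have "exp (c * (norm x)\<^sup>2) \<le> exp (c * s\<^sup>2)"
      using \<open>0 < c\<close> by (auto simp: t_def intro!: mult_left_mono power_mono)
    then show ?thesis
      by (intro add_increasing2) (auto intro: ennreal_leI)
  next
    case False
    obtain n where n: "norm x \<le> t (Suc n)" "t n < norm x"
    proof -
      have "norm x \<le> t (LEAST n. norm x \<le> t n)"
        using t_large by (rule LeastI_ex)
      moreover obtain n where "(LEAST n. norm x \<le> t n) = Suc n"
        using calculation False by (cases "LEAST n. norm x \<le> t n") auto
      moreover have "\<not> norm x \<le> t n"
        by (rule not_less_Least) (simp add: calculation)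
      ultimately show ?thesis using that by auto
    qed
    have "c * (norm x)\<^sup>2 \<le> c * (t (Suc n))\<^sup>2"
      using n(1) \<open>0 < c\<close> by (intro mult_left_mono power_mono) auto
    then have "ennreal (exp (c * (norm x)\<^sup>2)) \<le> ennreal (exp (2 ^ n)) * indicator {x. t n < norm x} x"
      using t_sq[of n] n(2) by (auto intro!: ennreal_leI)
    also have "\<dots> \<le> (\<Sum>n. ennreal (exp (2 ^ n)) * indicator {x. t n < norm x} x)"
      using sum_le_suminf[of "\<lambda>n. ennreal (exp (2 ^ n)) * indicator {x. t n < norm x} x" "{n}"]
      by (simp only: sum.insert sum.empty finite.intros empty_iff not_False_eq_True add_0_right summableI zero_le simp_thms)
    finally show ?thesis
      by (rule add_increasing[rotated]) simp
  qed
  have "(\<integral>\<^sup>+x. ennreal (exp (c * (norm x)\<^sup>2)) \<partial>\<gamma>) \<le>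
      (\<integral>\<^sup>+x. ennreal (exp (c * s\<^sup>2)) + (\<Sum>n. ennreal (exp (2 ^ n)) * indicator {x. t n < norm x} x) \<partial>\<gamma>)"
    by (intro nn_integral_mono pointwise)
  also have "\<dots> = ennreal (exp (c * s\<^sup>2)) + (\<Sum>n. ennreal (exp (2 ^ n)) * ennreal (tail (t n)))"
    by (simp add: nn_integral_add nn_integral_suminf nn_integral_cmult_indicator emeasure_space_1[simplified] emeasure_eq_measure tail_def prob_space[simplified])
  also have "\<dots> \<le> ennreal (exp (c * s\<^sup>2)) + (\<Sum>n. ennreal ((exp 1 / 3) ^ n))"
  proof (intro add_left_mono suminf_le summableI)
    fix n
    have e3: "exp 1 / 3 \<le> (1::real)" using e_less_272 by simp
    have "exp (2 ^ n) * tail (t n) \<le> exp (2 ^ n) * (1 / 3) ^ (2 ^ n)"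
      using tail_decay[OF s] by (intro mult_left_mono) (auto simp: t_def)
    also have "\<dots> = (exp 1 / 3) ^ (2 ^ n)"
      by (simp add: power_divide exp_of_nat_mult[symmetric])
    also have "\<dots> \<le> (exp 1 / 3) ^ n"
      using e3 by (intro power_decreasing) (auto simp: less_imp_le)
    finally show "ennreal (exp (2 ^ n)) * ennreal (tail (t n)) \<le> ennreal ((exp 1 / 3) ^ n)"
      by (simp add: ennreal_mult[symmetric] tail_def ennreal_leI)
  qed
  also have "\<dots> < \<infinity>"
  proof -
    have "summable (\<lambda>n. (exp 1 / 3 :: real) ^ n)"
      using e_less_272 by (intro summable_geometric) simp
    then have "(\<Sum>n. ennreal ((exp 1 / 3) ^ n)) \<noteq> top"
      by (intro ennreal_suminf_neq_top) auto
    then show ?thesis by (simp add: less_top)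
  qed
  finally show ?thesis using \<open>0 < c\<close> by blast
qed

end

section \<open>Kernels given by a random map, and their maximal coupling\<close>

text \<open>The kernel moves \<open>x\<close> to \<open>F x w\<close>, where \<open>w\<close> has the density \<open>D x\<close> with respect to a base measure
  \<open>N\<close> common to all states. The class of these kernels contains the maximal coupling of each of its members, so
  measurability is proved only once.\<close>

locale random_map_kernel = sigma_finite_measure N for N :: "'w measure" +
  fixes D :: "'a::second_countable_topology \<Rightarrow> 'w \<Rightarrow> ennreal" and F :: "'a \<Rightarrow> 'w \<Rightarrow> 'a"
  assumes D_measurable: "case_prod D \<in> borel_measurable (borel \<Otimes>\<^sub>M N)"
    and F_measurable: "case_prod F \<in> borel \<Otimes>\<^sub>M N \<rightarrow>\<^sub>M borel"
    and D_total: "(\<integral>\<^sup>+w. D x w \<partial>N) = 1"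
begin

lemma D_measurable_raw[measurable (raw)]:
  "f \<in> M \<rightarrow>\<^sub>M borel \<Longrightarrow> g \<in> M \<rightarrow>\<^sub>M N \<Longrightarrow> (\<lambda>z. D (f z) (g z)) \<in> borel_measurable M"
  using measurable_compose[OF measurable_Pair D_measurable] by simp

lemma F_measurable_raw[measurable (raw)]:
  "f \<in> M \<rightarrow>\<^sub>M borel \<Longrightarrow> g \<in> M \<rightarrow>\<^sub>M N \<Longrightarrow> (\<lambda>z. F (f z) (g z)) \<in> M \<rightarrow>\<^sub>M borel"
  using measurable_compose[OF measurable_Pair F_measurable] by simp

definition kernel :: "'a \<Rightarrow> 'a measure" where
  "kernel x = distr (density N (D x)) borel (F x)"

lemma nn_integral_kernel:
  assumes [measurable]: "g \<in> borel_measurable borel"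
  shows "(\<integral>\<^sup>+y. g y \<partial>kernel x) = (\<integral>\<^sup>+w. D x w * g (F x w) \<partial>N)"
  unfolding kernel_def by (subst nn_integral_distr) (simp_all add: nn_integral_density)

lemma kernel_measurable: "kernel \<in> borel \<rightarrow>\<^sub>M prob_algebra borel"
proof (rule measurable_prob_algebraI)
  show prob: "prob_space (kernel x)" for x
  proof
    have "emeasure (kernel x) (space (kernel x)) = (\<integral>\<^sup>+y. 1 \<partial>kernel x)" by simp
    also have "\<dots> = 1" by (subst nn_integral_kernel) (simp_all add: D_total)
    finally show "emeasure (kernel x) (space (kernel x)) = 1" .
  qed
  show "kernel \<in> borel \<rightarrow>\<^sub>M subprob_algebra borel"
  proof (rule measurable_subprob_algebra)
    fix A :: "'a set" assume [measurable]: "A \<in> sets borel"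
    have "emeasure (kernel x) A = (\<integral>\<^sup>+w. D x w * indicator A (F x w) \<partial>N)" for x
      using nn_integral_kernel[of "indicator A" x] by (simp add: kernel_def)
    then show "(\<lambda>x. emeasure (kernel x) A) \<in> borel_measurable borel"
      by simp
  next
    show "subprob_space (kernel x)" for x
      by (rule prob_space_imp_subprob_space[OF prob])
  qed (simp_all add: kernel_def)
qed

definition overlap :: "'a \<Rightarrow> 'a \<Rightarrow> 'w \<Rightarrow> ennreal" where
  "overlap x y w = min (D x w) (D y w)"

definition excess :: "'a \<Rightarrow> 'a \<Rightarrow> 'w \<Rightarrow> ennreal" where
  "excess x y w = D x w - overlap x y w"

definition defect :: "'a \<Rightarrow> 'a \<Rightarrow> ennreal" where
  "defect x y = 1 - (\<integral>\<^sup>+w. overlap x y w \<partial>N)"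

lemma overlap_commute: "overlap x y w = overlap y x w"
  by (simp add: overlap_def min.commute)

lemma defect_commute: "defect x y = defect y x"
  by (simp add: defect_def overlap_commute)

lemma overlap_add_excess: "overlap x y w + excess x y w = D x w"
  unfolding excess_def by (rule ennreal_ineq_diff_add[symmetric]) (simp add: overlap_def)

lemma overlap_measurable[measurable (raw)]:
  assumes [measurable]: "f \<in> M \<rightarrow>\<^sub>M borel" "f' \<in> M \<rightarrow>\<^sub>M borel" "g \<in> M \<rightarrow>\<^sub>M N"
  shows "(\<lambda>z. overlap (f z) (f' z) (g z)) \<in> borel_measurable M"
  unfolding overlap_def by measurable

lemma excess_measurable[measurable (raw)]:
  assumes [measurable]: "f \<in> M \<rightarrow>\<^sub>M borel" "f' \<in> M \<rightarrow>\<^sub>M borel" "g \<in> M \<rightarrow>\<^sub>M N"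
  shows "(\<lambda>z. excess (f z) (f' z) (g z)) \<in> borel_measurable M"
  unfolding excess_def by measurable

lemma defect_measurable[measurable (raw)]:
  assumes [measurable]: "f \<in> M \<rightarrow>\<^sub>M borel" "f' \<in> M \<rightarrow>\<^sub>M borel"
  shows "(\<lambda>z. defect (f z) (f' z)) \<in> borel_measurable M"
  unfolding defect_def by measurable

lemma overlap_total_le: "(\<integral>\<^sup>+w. overlap x y w \<partial>N) \<le> 1"
  unfolding D_total[of x, symmetric] by (intro nn_integral_mono) (simp add: overlap_def)

lemma excess_total: "(\<integral>\<^sup>+w. excess x y w \<partial>N) = defect x y"
proof -
  have "(\<integral>\<^sup>+w. overlap x y w \<partial>N) \<noteq> \<infinity>"
    using overlap_total_le[of x y] by (auto simp: top_unique)
  then show ?thesis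
    unfolding excess_def defect_def D_total[of x, symmetric]
    by (intro nn_integral_diff) (auto simp: overlap_def)
qed

lemma defect_le_1: "defect x y \<le> 1"
  by (simp add: defect_def)

text \<open>The maximal coupling of \<open>D x\<close> and \<open>D y\<close> has two branches: the common part \<open>overlap\<close>, where
  both states are moved by the same \<open>w\<close>, and the independent product of the two excesses, where \<open>x\<close>
  is moved by \<open>w\<close> and \<open>y\<close> by \<open>w'\<close>. The branch and both noises are drawn from one product measure. In
  the first branch \<open>w'\<close> gets the weight \<open>D x\<close> so that it integrates out to one. If the excesses
  vanish, the division by zero gives the second branch the weight zero, as it should.\<close>

definition coupling_base :: "(('w \<times> 'w) \<times> bool) measure" where
  "coupling_base = (N \<Otimes>\<^sub>M N) \<Otimes>\<^sub>M count_space UNIV"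

definition coupling_density :: "'a \<times> 'a \<Rightarrow> ('w \<times> 'w) \<times> bool \<Rightarrow> ennreal" where
  "coupling_density = (\<lambda>(x, y) ((w, w'), b).
     if b then overlap x y w * D x w' else excess x y w * excess y x w' / defect x y)"

definition coupling_map :: "'a \<times> 'a \<Rightarrow> ('w \<times> 'w) \<times> bool \<Rightarrow> 'a \<times> 'a" where
  "coupling_map = (\<lambda>(x, y) ((w, w'), b). (F x w, F y (if b then w else w')))"

lemma coupling_density_measurable[measurable]:
  "case_prod coupling_density \<in> borel_measurable (borel \<Otimes>\<^sub>M coupling_base)"
  unfolding coupling_density_def coupling_base_def case_prod_beta' borel_prod[symmetric] by measurable

lemma coupling_map_measurable[measurable]:
  "case_prod coupling_map \<in> borel \<Otimes>\<^sub>M coupling_base \<rightarrow>\<^sub>M borel"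
  unfolding coupling_map_def coupling_base_def case_prod_beta' borel_prod[symmetric] by measurable

lemma nn_integral_coupling_base:
  assumes g[measurable]: "g \<in> borel_measurable coupling_base"
  shows "(\<integral>\<^sup>+\<omega>. g \<omega> \<partial>coupling_base) = (\<integral>\<^sup>+w. \<integral>\<^sup>+w'. g ((w, w'), True) + g ((w, w'), False) \<partial>N \<partial>N)"
proof -
  interpret C: sigma_finite_measure "count_space (UNIV :: bool set)"
    by (rule sigma_finite_measure_count_space_finite) simp
  note g' = g[unfolded coupling_base_def]
  note [measurable] = g'
  have "(\<integral>\<^sup>+\<omega>. g \<omega> \<partial>coupling_base) = (\<integral>\<^sup>+p. \<integral>\<^sup>+b. g (p, b) \<partial>count_space UNIV \<partial>(N \<Otimes>\<^sub>M N))"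
    unfolding coupling_base_def by (rule C.nn_integral_fst[symmetric, OF g'])
  also have "\<dots> = (\<integral>\<^sup>+p. g (p, True) + g (p, False) \<partial>(N \<Otimes>\<^sub>M N))"
    by (simp add: nn_integral_count_space_finite UNIV_bool add.commute)
  also have "\<dots> = (\<integral>\<^sup>+w. \<integral>\<^sup>+w'. g ((w, w'), True) + g ((w, w'), False) \<partial>N \<partial>N)"
    by (subst nn_integral_fst[symmetric]) simp_all
  finally show ?thesis .
qed

lemma nn_integral_coupling:
  assumes [measurable]: "g \<in> borel_measurable borel"
  shows "(\<integral>\<^sup>+\<omega>. coupling_density (x, y) \<omega> * g (coupling_map (x, y) \<omega>) \<partial>coupling_base) =
    (\<integral>\<^sup>+w. overlap x y w * g (F x w, F y w) \<partial>N) +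
    (\<integral>\<^sup>+w. excess x y w * (\<integral>\<^sup>+w'. excess y x w' * g (F x w, F y w') \<partial>N) \<partial>N) / defect x y"
proof -
  have g[measurable]: "g \<in> borel_measurable (borel \<Otimes>\<^sub>M borel)"
    by (simp add: borel_prod)
  have [measurable]: "coupling_density (x, y) \<in> borel_measurable coupling_base"
    using measurable_compose[OF measurable_Pair1' coupling_density_measurable, of "(x, y)"] by simp
  have [measurable]: "coupling_map (x, y) \<in> coupling_base \<rightarrow>\<^sub>M borel"
    using measurable_compose[OF measurable_Pair1' coupling_map_measurable, of "(x, y)"] by simp
  have "(\<integral>\<^sup>+\<omega>. coupling_density (x, y) \<omega> * g (coupling_map (x, y) \<omega>) \<partial>coupling_base) =
      (\<integral>\<^sup>+w. \<integral>\<^sup>+w'. (overlap x y w * g (F x w, F y w)) * D x w' +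
        (excess x y w / defect x y) * (excess y x w' * g (F x w, F y w')) \<partial>N \<partial>N)"
    by (subst nn_integral_coupling_base, measurable)
       (simp add: coupling_density_def coupling_map_def divide_ennreal_def mult_ac)
  also have "\<dots> = (\<integral>\<^sup>+w. overlap x y w * g (F x w, F y w) +
        (excess x y w / defect x y) * (\<integral>\<^sup>+w'. excess y x w' * g (F x w, F y w') \<partial>N) \<partial>N)"
    by (simp add: nn_integral_add nn_integral_cmult D_total)
  also have "\<dots> = (\<integral>\<^sup>+w. overlap x y w * g (F x w, F y w) \<partial>N) +
    (\<integral>\<^sup>+w. (excess x y w * (\<integral>\<^sup>+w'. excess y x w' * g (F x w, F y w') \<partial>N)) * inverse (defect x y) \<partial>N)"
    by (subst nn_integral_add) (simp_all add: divide_ennreal_def mult_ac)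
  also have "\<dots> = (\<integral>\<^sup>+w. overlap x y w * g (F x w, F y w) \<partial>N) +
    (\<integral>\<^sup>+w. excess x y w * (\<integral>\<^sup>+w'. excess y x w' * g (F x w, F y w') \<partial>N) \<partial>N) / defect x y"
    by (subst nn_integral_multc) (simp_all add: divide_ennreal_def)
  finally show ?thesis .
qed

text \<open>If \<open>defect x y = 0\<close>, the excess vanishes almost everywhere and both sides are zero.\<close>

lemma excess_cancel:
  assumes [measurable]: "h \<in> borel_measurable N"
  shows "(\<integral>\<^sup>+w. excess x y w * h w \<partial>N) * defect x y / defect x y = (\<integral>\<^sup>+w. excess x y w * h w \<partial>N)"
proof (cases "defect x y = 0")
  case True
  then have "AE w in N. excess x y w = 0"
    using excess_total[of x y] by (simp add: nn_integral_0_iff_AE)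
  then have "(\<integral>\<^sup>+w. excess x y w * h w \<partial>N) = 0"
    by (subst nn_integral_0_iff_AE) auto
  then show ?thesis by simp
next
  case False
  moreover have "defect x y \<noteq> top"
    using defect_le_1[of x y] by (auto simp: top_unique)
  ultimately show ?thesis
    by (simp add: ennreal_mult_divide_eq)
qed

lemma nn_integral_coupling_fst:
  assumes [measurable]: "h \<in> borel_measurable borel"
  shows "(\<integral>\<^sup>+\<omega>. coupling_density (x, y) \<omega> * h (fst (coupling_map (x, y) \<omega>)) \<partial>coupling_base) =
    (\<integral>\<^sup>+w. D x w * h (F x w) \<partial>N)"
proof -
  have [measurable]: "(\<lambda>p::'a \<times> 'a. h (fst p)) \<in> borel_measurable borel"
    unfolding borel_prod[symmetric] by measurable
  have "(\<integral>\<^sup>+\<omega>. coupling_density (x, y) \<omega> * h (fst (coupling_map (x, y) \<omega>)) \<partial>coupling_base) =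
    (\<integral>\<^sup>+w. overlap x y w * h (F x w) \<partial>N) +
    (\<integral>\<^sup>+w. excess x y w * (h (F x w) * defect x y) \<partial>N) / defect x y"
    by (subst nn_integral_coupling[of "\<lambda>p. h (fst p)"])
       (simp_all add: nn_integral_multc excess_total defect_commute[of y] mult.commute[of _ "h _"] nn_integral_cmult)
  also have "\<dots> = (\<integral>\<^sup>+w. overlap x y w * h (F x w) \<partial>N) + (\<integral>\<^sup>+w. excess x y w * h (F x w) \<partial>N)"
    by (simp add: nn_integral_multc excess_cancel mult.assoc[symmetric])
  also have "\<dots> = (\<integral>\<^sup>+w. D x w * h (F x w) \<partial>N)"
    by (simp add: nn_integral_add[symmetric] distrib_right[symmetric] overlap_add_excess)
  finally show ?thesis .
qed

lemma nn_integral_coupling_snd: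
  assumes [measurable]: "h \<in> borel_measurable borel"
  shows "(\<integral>\<^sup>+\<omega>. coupling_density (x, y) \<omega> * h (snd (coupling_map (x, y) \<omega>)) \<partial>coupling_base) =
    (\<integral>\<^sup>+w. D y w * h (F y w) \<partial>N)"
proof -
  have [measurable]: "(\<lambda>p::'a \<times> 'a. h (snd p)) \<in> borel_measurable borel"
    unfolding borel_prod[symmetric] by measurable
  have "(\<integral>\<^sup>+\<omega>. coupling_density (x, y) \<omega> * h (snd (coupling_map (x, y) \<omega>)) \<partial>coupling_base) =
    (\<integral>\<^sup>+w. overlap y x w * h (F y w) \<partial>N) +
    (\<integral>\<^sup>+w. excess y x w * h (F y w) \<partial>N) * defect y x / defect y x"
    by (subst nn_integral_coupling[of "\<lambda>p. h (snd p)"])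
       (simp_all add: nn_integral_multc excess_total defect_commute[of y] overlap_commute[of y] mult.commute)
  also have "\<dots> = (\<integral>\<^sup>+w. overlap y x w * h (F y w) \<partial>N) + (\<integral>\<^sup>+w. excess y x w * h (F y w) \<partial>N)"
    by (simp add: excess_cancel)
  also have "\<dots> = (\<integral>\<^sup>+w. D y w * h (F y w) \<partial>N)"
    by (simp add: nn_integral_add[symmetric] distrib_right[symmetric] overlap_add_excess)
  finally show ?thesis .
qed

lemma coupling_random_map_kernel: "random_map_kernel coupling_base coupling_density coupling_map"
proof -
  have "sigma_finite_measure coupling_base"
    unfolding coupling_base_def
    by (intro sigma_finite_pair_measure sigma_finite_measure_axioms sigma_finite_measure_count_space_finite) simp
  moreover
  have "(\<integral>\<^sup>+\<omega>. coupling_density z \<omega> \<partial>coupling_base) = 1" for z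
    using nn_integral_coupling_fst[of "\<lambda>_. 1" "fst z" "snd z"] by (simp add: D_total)
  ultimately show ?thesis
    by (simp add: random_map_kernel_def random_map_kernel_axioms_def coupling_base_def[symmetric])
qed

lemma coupling_kernel:
  obtains K where "K \<in> borel \<rightarrow>\<^sub>M prob_algebra (borel :: ('a \<times> 'a) measure)"
    and "\<And>x y. distr (K (x, y)) borel fst = kernel x"
    and "\<And>x y. distr (K (x, y)) borel snd = kernel y"
    and "\<And>x y g. g \<in> borel_measurable borel \<Longrightarrow> (\<And>p. g p \<le> 1) \<Longrightarrow>
      (\<integral>\<^sup>+p. g p \<partial>K (x, y)) \<le> (\<integral>\<^sup>+w. overlap x y w * g (F x w, F y w) \<partial>N) + defect x y"
proof -
  interpret K: random_map_kernel coupling_base coupling_density coupling_map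
    by (rule coupling_random_map_kernel)
  have [measurable]: "fst \<in> (borel :: ('a \<times> 'a) measure) \<rightarrow>\<^sub>M borel" "snd \<in> (borel :: ('a \<times> 'a) measure) \<rightarrow>\<^sub>M borel"
    unfolding borel_prod[symmetric] by measurable
  have sets_K[measurable_cong]: "sets (K.kernel z) = sets borel" for z
    by (simp add: K.kernel_def)
  show thesis
  proof (rule that[of K.kernel])
    show "K.kernel \<in> borel \<rightarrow>\<^sub>M prob_algebra borel"
      by (rule K.kernel_measurable)
    show "distr (K.kernel (x, y)) borel fst = kernel x" for x y
    proof (rule measure_eqI)
      fix A assume "A \<in> sets (distr (K.kernel (x, y)) borel fst)"
      then have [measurable]: "A \<in> sets borel" by simp
      have "emeasure (distr (K.kernel (x, y)) borel fst) A = (\<integral>\<^sup>+z. indicator A (fst z) \<partial>K.kernel (x, y))"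
        by (subst nn_integral_indicator[symmetric], simp, subst nn_integral_distr) simp_all
      also have "\<dots> = (\<integral>\<^sup>+y. indicator A y \<partial>kernel x)"
        by (simp add: K.nn_integral_kernel nn_integral_kernel nn_integral_coupling_fst)
      finally show "emeasure (distr (K.kernel (x, y)) borel fst) A = emeasure (kernel x) A"
        by (simp add: kernel_def)
    qed (simp add: kernel_def)
    show "distr (K.kernel (x, y)) borel snd = kernel y" for x y
    proof (rule measure_eqI)
      fix A assume "A \<in> sets (distr (K.kernel (x, y)) borel snd)"
      then have [measurable]: "A \<in> sets borel" by simp
      have "emeasure (distr (K.kernel (x, y)) borel snd) A = (\<integral>\<^sup>+z. indicator A (snd z) \<partial>K.kernel (x, y))"
        by (subst nn_integral_indicator[symmetric], simp, subst nn_integral_distr) simp_all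
      also have "\<dots> = (\<integral>\<^sup>+z. indicator A z \<partial>kernel y)"
        by (simp add: K.nn_integral_kernel nn_integral_kernel nn_integral_coupling_snd)
      finally show "emeasure (distr (K.kernel (x, y)) borel snd) A = emeasure (kernel y) A"
        by (simp add: kernel_def)
    qed (simp add: kernel_def)
    fix x y and g :: "'a \<times> 'a \<Rightarrow> ennreal"
    assume [measurable]: "g \<in> borel_measurable borel" and g1: "\<And>p. g p \<le> 1"
    have "(\<integral>\<^sup>+w. excess x y w * (\<integral>\<^sup>+w'. excess y x w' * g (F x w, F y w') \<partial>N) \<partial>N) \<le>
        (\<integral>\<^sup>+w. excess x y w * (\<integral>\<^sup>+w'. excess y x w' * 1 \<partial>N) \<partial>N)"
      by (intro nn_integral_mono mult_left_mono g1) simp_all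
    also have "\<dots> = (\<integral>\<^sup>+w. excess x y w * 1 \<partial>N) * defect x y"
      by (simp add: excess_total defect_commute[of y] nn_integral_multc)
    finally have "(\<integral>\<^sup>+w. excess x y w * (\<integral>\<^sup>+w'. excess y x w' * g (F x w, F y w') \<partial>N) \<partial>N) / defect x y \<le>
        (\<integral>\<^sup>+w. excess x y w * 1 \<partial>N) * defect x y / defect x y"
      by (rule divide_right_mono_ennreal)
    also have "\<dots> = defect x y"
      by (subst excess_cancel) (simp_all add: excess_total)
    finally show "(\<integral>\<^sup>+p. g p \<partial>K.kernel (x, y)) \<le> (\<integral>\<^sup>+w. overlap x y w * g (F x w, F y w) \<partial>N) + defect x y"
      by (simp add: K.nn_integral_kernel nn_integral_coupling add_left_mono)
  qed
qed

end

section \<open>A concave distance function and the real inequalities\<close>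

text \<open>At small distances the function is linear up to constants, and at large distances it approaches
  its bound only polynomially. The latter keeps common moves profitable far away: with
  \<open>h u = 1 / (1 + u) ^ q\<close>, moving from \<open>u\<close> to \<open>\<rho> u\<close> multiplies the gap \<open>h\<close> to the bound by a factor that
  can be made large by the choice of \<open>q\<close>.\<close>

definition saturating :: "nat \<Rightarrow> real \<Rightarrow> real" where
  "saturating q u = 1 - 1 / (1 + u) ^ q"

lemma saturating_nonneg: "0 \<le> u \<Longrightarrow> 0 \<le> saturating q u"
  by (simp add: saturating_def)

lemma saturating_le_1: "0 \<le> u \<Longrightarrow> saturating q u \<le> 1"
  by (simp add: saturating_def)

lemma saturating_le_linear: "0 \<le> u \<Longrightarrow> saturating q u \<le> q * (u / (1 + u))"
proof -
  assume u: "0 \<le> u"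
  have "1 + q * (- (u / (1 + u))) \<le> (1 + (- (u / (1 + u)))) ^ q"
    using u by (intro Bernoulli_inequality) (simp add: field_simps)
  also have "1 + (- (u / (1 + u))) = 1 / (1 + u)"
    using u by (simp add: field_simps)
  finally show ?thesis by (simp add: saturating_def power_divide)
qed

text \<open>Here \<open>p\<close>, \<open>j\<close> and \<open>\<delta>\<close> are the probabilities of a common move, a common rejection and differing
  decisions. With \<open>h u = 1 / (1 + u) ^ q\<close>, the common moves gain \<open>p (h (\<rho> u) - h u)\<close>, which is at least
  \<open>3 h u (u / (1 + u))\<close> by Bernoulli's inequality, while the differing decisions lose \<open>\<delta> h u\<close>, at most
  \<open>min 1 u h u \<le> 2 h u (u / (1 + u))\<close>.\<close>

lemma saturating_contraction:
  fixes a p j \<delta> u \<rho> :: real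
  assumes u: "0 \<le> u" and \<rho>: "0 \<le> \<rho>" "\<rho> < 1" and q: "3 \<le> a * q * (1 - \<rho>)" "0 < q"
    and p: "a \<le> p" "0 \<le> a" and \<delta>: "0 \<le> \<delta>" "\<delta> \<le> 1" "\<delta> \<le> u" and total: "p + j + \<delta> = 1"
  shows "p * saturating q (\<rho> * u) + j * saturating q u + \<delta> \<le> (1 - 1 / (q * (1 + u) ^ q)) * saturating q u"
proof -
  define h where "h w = 1 / (1 + w) ^ q" for w :: real
  have h_pos: "0 < h u" using u by (simp add: h_def)
  have "q * ((1 - \<rho>) * u / (1 + u)) \<le> q * ((1 - \<rho>) * u / (1 + \<rho> * u))"
  proof (intro mult_left_mono divide_left_mono)
    show "1 + \<rho> * u \<le> 1 + u" using u \<rho> by (simp add: mult_left_le_one_le)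
    show "0 < (1 + u) * (1 + \<rho> * u)" using u \<rho> by (intro mult_pos_pos add_pos_nonneg) auto
  qed (use u \<rho> in auto)
  also have "1 + q * ((1 - \<rho>) * u / (1 + \<rho> * u)) \<le> (1 + (1 - \<rho>) * u / (1 + \<rho> * u)) ^ q"
    using u \<rho> by (intro Bernoulli_inequality) (smt (verit) divide_nonneg_nonneg mult_nonneg_nonneg)
  also have "1 + (1 - \<rho>) * u / (1 + \<rho> * u) = (1 + u) / (1 + \<rho> * u)"
  proof -
    have "0 < 1 + \<rho> * u" using u \<rho> by (intro add_pos_nonneg) auto
    then show ?thesis by (simp add: field_simps)
  qed
  also have "((1 + u) / (1 + \<rho> * u)) ^ q = h (\<rho> * u) / h u"
    by (simp add: h_def power_divide)
  finally have "1 + q * ((1 - \<rho>) * u / (1 + u)) \<le> h (\<rho> * u) / h u" by simp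
  then have drop: "h u * (q * (1 - \<rho>) * (u / (1 + u))) \<le> h (\<rho> * u) - h u"
    using h_pos by (simp add: field_simps)
  have "3 * (u / (1 + u)) \<le> (a * q * (1 - \<rho>)) * (u / (1 + u))"
    using u by (intro mult_right_mono q) auto
  also have "\<dots> \<le> (p * q * (1 - \<rho>)) * (u / (1 + u))"
    using u p \<rho> by (intro mult_right_mono) auto
  finally have "h u * (3 * (u / (1 + u))) \<le> h u * ((p * q * (1 - \<rho>)) * (u / (1 + u)))"
    using h_pos by (intro mult_left_mono) auto
  also have "\<dots> = p * (h u * (q * (1 - \<rho>) * (u / (1 + u))))"
    by (simp add: mult_ac)
  also have "\<dots> \<le> p * (h (\<rho> * u) - h u)"
    using p by (intro mult_left_mono drop) auto
  finally have gain: "h u * (3 * (u / (1 + u))) \<le> p * (h (\<rho> * u) - h u)" .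
  have "\<delta> \<le> 2 * (u / (1 + u))"
  proof (cases "u \<le> 1")
    case True
    then have "u * (1 + u) \<le> u * 2" using u by (intro mult_left_mono) auto
    then have "u \<le> 2 * (u / (1 + u))" using u by (simp add: field_simps)
    then show ?thesis using \<delta> by linarith
  next
    case False
    then have "1 \<le> 2 * (u / (1 + u))" by (simp add: field_simps)
    then show ?thesis using \<delta> by linarith
  qed
  then have loss: "\<delta> * h u \<le> h u * (2 * (u / (1 + u)))"
    using h_pos mult_left_mono[of \<delta> _ "h u"] by (simp only: mult.commute[of \<delta>] less_imp_le)
  have "h u / q * saturating q u \<le> h u / q * (q * (u / (1 + u)))"
    using h_pos q u by (intro mult_left_mono saturating_le_linear) auto
  also have "\<dots> = h u * (u / (1 + u))"
    using q by simp
  finally have "h u / q * saturating q u \<le> h u * (u / (1 + u))" .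
  moreover have "h u * (3 * (u / (1 + u))) = 3 * (h u * (u / (1 + u)))" "h u * (2 * (u / (1 + u))) = 2 * (h u * (u / (1 + u)))"
    by simp_all
  ultimately have "\<delta> * h u - p * (h (\<rho> * u) - h u) \<le> - (h u / q * saturating q u)"
    using gain loss by argo
  moreover have "p * saturating q (\<rho> * u) + j * saturating q u + \<delta> =
      saturating q u + (\<delta> * h u - p * (h (\<rho> * u) - h u))"
  proof -
    have j: "j = 1 - p - \<delta>" using total by simp
    show ?thesis unfolding saturating_def h_def[symmetric] j by (simp add: algebra_simps)
  qed
  moreover have "(1 - 1 / (q * (1 + u) ^ q)) * saturating q u = saturating q u - h u / q * saturating q u"
    by (simp add: h_def algebra_simps)
  ultimately show ?thesis by linarith
qed

text \<open>Both functions are linear near zero and bounded away from zero elsewhere. The scales \<open>\<epsilon>\<close> and \<open>\<eta>\<close> are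
  unrelated: the former is prescribed by the metric, the latter by the dynamics.\<close>

lemma saturating_equiv:
  assumes "0 < \<epsilon>" "0 < \<eta>" "0 < q"
  obtains a b :: real where "0 < a" "0 < b"
    "\<And>r. 0 \<le> r \<Longrightarrow> a * min 1 (r / \<epsilon>) \<le> saturating q (r / \<eta>)"
    "\<And>r. 0 \<le> r \<Longrightarrow> saturating q (r / \<eta>) \<le> b * min 1 (r / \<epsilon>)"
proof
  define a where "a = \<epsilon> / (\<eta> + \<epsilon>)"
  define b where "b = max 1 (q * \<epsilon> / \<eta>)"
  show "0 < a" "0 < b" using assms by (auto simp: a_def b_def add_pos_pos)
  fix r :: real assume r: "0 \<le> r"
  have *: "(r / \<eta>) / (1 + r / \<eta>) \<le> saturating q (r / \<eta>)"
  proof -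
    have "1 / (1 + r / \<eta>) ^ q \<le> 1 / (1 + r / \<eta>) ^ 1"
      using r assms by (intro divide_left_mono power_increasing mult_pos_pos zero_less_power add_pos_nonneg) auto
    moreover have "(r / \<eta>) / (1 + r / \<eta>) = 1 - 1 / (1 + r / \<eta>)"
      using r assms by (simp add: field_simps)
    ultimately show ?thesis by (simp add: saturating_def)
  qed
  have "1 * saturating q (r / \<eta>) \<le> b * min 1 (r / \<epsilon>)"
  proof (cases "r \<le> \<epsilon>")
    case True
    have "saturating q (r / \<eta>) \<le> q * ((r / \<eta>) / (1 + r / \<eta>))"
      using r assms by (intro saturating_le_linear) auto
    also have "\<dots> \<le> q * (r / \<eta> / 1)"
      using r assms by (intro mult_left_mono divide_left_mono) (auto intro: add_pos_nonneg)
    also have "\<dots> = (q * \<epsilon> / \<eta>) * (r / \<epsilon>)"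
      using assms by simp
    also have "\<dots> \<le> b * (r / \<epsilon>)"
      using r assms by (intro mult_right_mono) (auto simp: b_def)
    also have "r / \<epsilon> = min 1 (r / \<epsilon>)"
      using True assms by (intro min_absorb2[symmetric]) simp
    finally show ?thesis by simp
  next
    case False
    then have "min 1 (r / \<epsilon>) = 1" using assms by (simp add: min_def field_simps)
    moreover have "saturating q (r / \<eta>) \<le> 1" using r assms by (simp add: saturating_le_1)
    ultimately show ?thesis by (simp add: b_def)
  qed
  then show "saturating q (r / \<eta>) \<le> b * min 1 (r / \<epsilon>)" by simp
  show "a * min 1 (r / \<epsilon>) \<le> saturating q (r / \<eta>)"
  proof (cases "r \<le> \<epsilon>")
    case True
    have "a * min 1 (r / \<epsilon>) \<le> r / (\<eta> + \<epsilon>)"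
      using True assms by (simp add: min_def a_def field_simps)
    also have "\<dots> \<le> r / (\<eta> + r)"
      using True assms r by (intro divide_left_mono) auto
    also have "\<dots> = (r / \<eta>) / (1 + r / \<eta>)"
      using assms r by (simp add: field_simps)
    finally show ?thesis using * by simp
  next
    case False
    have "a * min 1 (r / \<epsilon>) \<le> a * 1"
      using \<open>0 < a\<close> by (intro mult_left_mono) auto
    also have "\<dots> \<le> (r / \<eta>) / (1 + r / \<eta>)"
      using False assms by (simp add: a_def field_simps)
    finally show ?thesis using * by simp
  qed
qed

text \<open>The bookkeeping of the weak Harris argument; \<open>S\<close> stands for \<open>V x + V y\<close> and \<open>\<sigma>\<close> for the relative
  contraction of the distance. For small \<open>S\<close> the distance contracts by \<open>1 - s\<close>, and \<open>\<beta> = s / (4 B)\<close> is so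
  small that the growth of the weight costs only half of this. For large \<open>S\<close> the Lyapunov drift
  makes the weight itself contract.\<close>

lemma harris_real_inequality:
  fixes l B s :: real
  assumes l: "0 \<le> l" "l < 1" and B: "0 < B" and s: "0 < s" "s \<le> 1"
  obtains \<beta> c :: real where "0 < \<beta>" "0 \<le> c" "c < 1"
    "\<And>S \<sigma>. 0 \<le> S \<Longrightarrow> 0 \<le> \<sigma> \<Longrightarrow> \<sigma> \<le> 1 \<Longrightarrow> (S \<le> 4 * B / (1 - l) \<Longrightarrow> s \<le> \<sigma>) \<Longrightarrow>
      (1 - \<sigma>) * (1 + \<beta> * (l * S + 2 * B)) \<le> c\<^sup>2 * (1 + \<beta> * S)"
proof
  define \<beta> where "\<beta> = s / (4 * B)"
  define \<kappa> where "\<kappa> = min ((1 - l) / 4) (\<beta> * B)"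
  define c where "c = sqrt (max (1 - s / 2) (1 - \<kappa>))"
  show \<beta>: "0 < \<beta>" using B s by (simp add: \<beta>_def)
  have \<kappa>: "0 < \<kappa>" "\<kappa> \<le> (1 - l) / 4" "\<kappa> \<le> \<beta> * B" using \<beta> B l by (auto simp: \<kappa>_def min_def)
  have c2: "c\<^sup>2 = max (1 - s / 2) (1 - \<kappa>)" using s by (simp add: c_def max_def)
  show "0 \<le> c" "c < 1" using s \<kappa> by (auto simp: c_def max_def)
  fix S \<sigma> :: real assume S: "0 \<le> S" and \<sigma>: "0 \<le> \<sigma>" "\<sigma> \<le> 1" and near: "S \<le> 4 * B / (1 - l) \<Longrightarrow> s \<le> \<sigma>"
  have E: "0 \<le> 1 + \<beta> * (l * S + 2 * B)" "0 \<le> 1 + \<beta> * S" using S l B \<beta> by auto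
  show "(1 - \<sigma>) * (1 + \<beta> * (l * S + 2 * B)) \<le> c\<^sup>2 * (1 + \<beta> * S)"
  proof (cases "S \<le> 4 * B / (1 - l)")
    case True
    have \<beta>B: "2 * \<beta> * B = s / 2" using B by (simp add: \<beta>_def)
    have "\<beta> * (l * S) \<le> \<beta> * S" using S l \<beta> by (intro mult_left_mono) (auto simp: mult_left_le_one_le)
    moreover have "0 \<le> (2 * \<beta> * B) * (\<beta> * S)" using \<beta> B S by auto
    ultimately have "1 + \<beta> * (l * S + 2 * B) \<le> (1 + 2 * \<beta> * B) * (1 + \<beta> * S)"
      by (simp add: algebra_simps)
    then have "(1 - \<sigma>) * (1 + \<beta> * (l * S + 2 * B)) \<le> (1 - s) * ((1 + s / 2) * (1 + \<beta> * S))"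
      using \<sigma> near[OF True] s E unfolding \<beta>B by (intro mult_mono) auto
    also have "\<dots> = ((1 - s) * (1 + s / 2)) * (1 + \<beta> * S)" by simp
    also have "\<dots> \<le> c\<^sup>2 * (1 + \<beta> * S)"
    proof (intro mult_right_mono E)
      have "(1 - s) * (1 + s / 2) \<le> 1 - s / 2" using s by (simp add: algebra_simps)
      then show "(1 - s) * (1 + s / 2) \<le> c\<^sup>2" by (simp add: c2)
    qed
    finally show ?thesis .
  next
    case False
    then have far: "4 * B \<le> (1 - l) * S" using l by (simp add: field_simps)
    have "\<kappa> * S \<le> (1 - l) / 4 * S" using S \<kappa> by (intro mult_right_mono) auto
    then have "\<kappa> * S + B \<le> (1 - l) * S - 2 * B" using far by simp
    then have "\<beta> * (\<kappa> * S + B) \<le> \<beta> * ((1 - l) * S - 2 * B)" using \<beta> by (intro mult_left_mono) auto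
    then have "1 + \<beta> * (l * S + 2 * B) \<le> (1 - \<kappa>) * (1 + \<beta> * S)"
      using \<kappa>(3) by (simp add: algebra_simps)
    moreover have "(1 - \<sigma>) * (1 + \<beta> * (l * S + 2 * B)) \<le> 1 * (1 + \<beta> * (l * S + 2 * B))"
      using \<sigma> E by (intro mult_right_mono) auto
    moreover have "(1 - \<kappa>) * (1 + \<beta> * S) \<le> c\<^sup>2 * (1 + \<beta> * S)"
      using E by (intro mult_right_mono) (auto simp: c2)
    ultimately show ?thesis by argo
  qed
qed

section \<open>Coupling kernels and the Wasserstein distance\<close>

lemma sets_couplings: "\<pi> \<in> couplings \<nu>1 \<nu>2 \<Longrightarrow> sets \<pi> = sets (borel :: ('a::second_countable_topology \<times> 'a) measure)"
  unfolding couplings_def borel_prod by simp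

lemma kernel_pow_measurable:
  assumes "P \<in> borel \<rightarrow>\<^sub>M prob_algebra borel"
  shows "kernel_pow P n \<in> borel \<rightarrow>\<^sub>M prob_algebra borel"
  by (induction n) (auto intro: measurable_bind_prob_space assms measurable_return_prob_space)

lemma bind_kernel_pow_Suc:
  assumes P: "P \<in> borel \<rightarrow>\<^sub>M prob_algebra borel" and "sets \<nu> = sets borel"
  shows "bind \<nu> (kernel_pow P (Suc n)) = bind (bind \<nu> (kernel_pow P n)) P"
proof -
  have "kernel_pow P n \<in> \<nu> \<rightarrow>\<^sub>M subprob_algebra borel"
    using measurable_prob_algebraD[OF kernel_pow_measurable[OF P]] assms(2)
    by (simp cong: measurable_cong_sets)
  from bind_assoc[OF this measurable_prob_algebraD[OF P]] show ?thesis
    by simp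
qed

locale kernel_coupling =
  fixes P :: "'a::second_countable_topology \<Rightarrow> 'a measure" and K :: "'a \<times> 'a \<Rightarrow> ('a \<times> 'a) measure"
  assumes P_measurable: "P \<in> borel \<rightarrow>\<^sub>M prob_algebra borel"
    and K_measurable: "K \<in> borel \<rightarrow>\<^sub>M prob_algebra borel"
    and K_fst: "distr (K (x, y)) borel fst = P x"
    and K_snd: "distr (K (x, y)) borel snd = P y"
begin

lemma fst_snd_measurable[measurable]:
  "fst \<in> (borel :: ('a \<times> 'a) measure) \<rightarrow>\<^sub>M borel" "snd \<in> (borel :: ('a \<times> 'a) measure) \<rightarrow>\<^sub>M borel"
  unfolding borel_prod[symmetric] by measurable

lemma sets_K: "sets (K z) = sets borel"
  using measurable_space[OF K_measurable, of z] by (simp add: space_prob_algebra)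

lemma bind_couplings:
  assumes \<pi>: "\<pi> \<in> couplings \<nu>1 \<nu>2"
  shows "bind \<pi> K \<in> couplings (bind \<nu>1 P) (bind \<nu>2 P)"
proof -
  note [measurable_cong] = sets_couplings[OF \<pi>]
  have ne: "space \<pi> \<noteq> {}"
    using sets_eq_imp_space_eq[OF sets_couplings[OF \<pi>]] by simp
  have K: "K \<in> \<pi> \<rightarrow>\<^sub>M subprob_algebra borel"
    using measurable_prob_algebraD[OF K_measurable] sets_couplings[OF \<pi>] by (simp cong: measurable_cong_sets)
  have P: "P \<in> borel \<rightarrow>\<^sub>M subprob_algebra borel"
    using measurable_prob_algebraD[OF P_measurable] .
  have "distr (bind \<pi> K) borel fst = bind \<pi> (\<lambda>z. P (fst z))"
    using distr_bind[OF K ne, of fst borel] K_fst[of "fst z" "snd z" for z] by simp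
  moreover have "\<dots> = bind \<nu>1 P"
    using bind_distr[OF _ P ne, of fst] \<pi> by (simp add: couplings_def)
  moreover have "distr (bind \<pi> K) borel snd = bind \<pi> (\<lambda>z. P (snd z))"
    using distr_bind[OF K ne, of snd borel] K_snd[of "fst z" "snd z" for z] by simp
  moreover have "\<dots> = bind \<nu>2 P"
    using bind_distr[OF _ P ne, of snd] \<pi> by (simp add: couplings_def)
  moreover have "sets (bind \<pi> K) = sets (borel \<Otimes>\<^sub>M borel)"
    unfolding borel_prod by (rule sets_bind[OF sets_K ne])
  ultimately show ?thesis
    by (simp add: couplings_def)
qed

text \<open>Composing a coupling of the initial laws with the coupling kernel \<open>n\<close> times avoids any measurable
  selection of optimal couplings.\<close>

lemma couplings_kernel_pow:
  assumes d[measurable]: "d \<in> borel_measurable borel"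
    and contr: "\<And>z. (\<integral>\<^sup>+p. d p \<partial>K z) \<le> c * d z"
    and \<nu>: "sets \<nu>1 = sets borel" "sets \<nu>2 = sets borel" and \<pi>: "\<pi> \<in> couplings \<nu>1 \<nu>2"
  shows "\<exists>\<pi>'\<in>couplings (bind \<nu>1 (kernel_pow P n)) (bind \<nu>2 (kernel_pow P n)).
    (\<integral>\<^sup>+p. d p \<partial>\<pi>') \<le> c ^ n * (\<integral>\<^sup>+p. d p \<partial>\<pi>)"
proof (induction n)
  case 0
  show ?case using \<pi> \<nu> by (auto simp: bind_return'' intro!: bexI[of _ \<pi>])
next
  case (Suc n)
  then obtain \<pi>' where \<pi>': "\<pi>' \<in> couplings (bind \<nu>1 (kernel_pow P n)) (bind \<nu>2 (kernel_pow P n))"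
    "(\<integral>\<^sup>+p. d p \<partial>\<pi>') \<le> c ^ n * (\<integral>\<^sup>+p. d p \<partial>\<pi>)" by blast
  note [measurable_cong] = sets_couplings[OF \<pi>'(1)]
  have K: "K \<in> \<pi>' \<rightarrow>\<^sub>M subprob_algebra borel"
    using measurable_prob_algebraD[OF K_measurable] sets_couplings[OF \<pi>'(1)] by (simp cong: measurable_cong_sets)
  have "(\<integral>\<^sup>+p. d p \<partial>bind \<pi>' K) = (\<integral>\<^sup>+z. \<integral>\<^sup>+p. d p \<partial>K z \<partial>\<pi>')"
    by (rule nn_integral_bind[OF d K])
  also have "\<dots> \<le> (\<integral>\<^sup>+z. c * d z \<partial>\<pi>')"
    by (intro nn_integral_mono contr)
  also have "\<dots> = c * (\<integral>\<^sup>+z. d z \<partial>\<pi>')"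
    by (rule nn_integral_cmult) simp
  also have "\<dots> \<le> c * (c ^ n * (\<integral>\<^sup>+p. d p \<partial>\<pi>))"
    by (intro mult_left_mono \<pi>') simp
  finally have "(\<integral>\<^sup>+p. d p \<partial>bind \<pi>' K) \<le> c ^ Suc n * (\<integral>\<^sup>+p. d p \<partial>\<pi>)"
    by (simp add: mult.assoc)
  then show ?case
    using bind_couplings[OF \<pi>'(1)] \<nu> by (metis bind_kernel_pow_Suc[OF P_measurable])
qed

lemma wasserstein_kernel_pow_le:
  fixes d d' :: "'a \<Rightarrow> 'a \<Rightarrow> real"
  assumes d': "case_prod d' \<in> borel_measurable borel"
    and contr: "\<And>x y. (\<integral>\<^sup>+p. ennreal (d' (fst p) (snd p)) \<partial>K (x, y)) \<le> ennreal c * ennreal (d' x y)" "0 \<le> c"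
    and ab: "0 < a" "0 < b" "\<And>x y. a * d x y \<le> d' x y" "\<And>x y. d' x y \<le> b * d x y"
    and d[measurable]: "case_prod d \<in> borel_measurable borel"
    and \<nu>: "sets \<nu>1 = sets borel" "sets \<nu>2 = sets borel"
    and r: "0 < r" "b / a * c ^ n \<le> r"
  shows "wasserstein d (bind \<nu>1 (kernel_pow P n)) (bind \<nu>2 (kernel_pow P n)) \<le> ennreal r * wasserstein d \<nu>1 \<nu>2"
proof -
  let ?\<nu>1 = "bind \<nu>1 (kernel_pow P n)" and ?\<nu>2 = "bind \<nu>2 (kernel_pow P n)"
  have [measurable]: "(\<lambda>p. d (fst p) (snd p)) \<in> borel_measurable borel" "(\<lambda>p. d' (fst p) (snd p)) \<in> borel_measurable borel"
    using d d' by (simp_all add: case_prod_beta')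
  have "wasserstein d ?\<nu>1 ?\<nu>2 \<le> ennreal r * (\<integral>\<^sup>+p. ennreal (d (fst p) (snd p)) \<partial>\<pi>)"
    if \<pi>: "\<pi> \<in> couplings \<nu>1 \<nu>2" for \<pi>
  proof -
    note [measurable_cong] = sets_couplings[OF \<pi>]
    obtain \<pi>' where \<pi>': "\<pi>' \<in> couplings ?\<nu>1 ?\<nu>2"
      "(\<integral>\<^sup>+p. ennreal (d' (fst p) (snd p)) \<partial>\<pi>') \<le> ennreal c ^ n * (\<integral>\<^sup>+p. ennreal (d' (fst p) (snd p)) \<partial>\<pi>)"
      using couplings_kernel_pow[of "\<lambda>p. ennreal (d' (fst p) (snd p))" "ennreal c" \<nu>1 \<nu>2 \<pi> n] contr \<nu> \<pi>
      by auto
    note [measurable_cong] = sets_couplings[OF \<pi>'(1)]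
    have "wasserstein d ?\<nu>1 ?\<nu>2 \<le> (\<integral>\<^sup>+p. ennreal (d (fst p) (snd p)) \<partial>\<pi>')"
      unfolding wasserstein_def by (rule INF_lower[OF \<pi>'(1)])
    also have "\<dots> \<le> (\<integral>\<^sup>+p. ennreal (1 / a) * ennreal (d' (fst p) (snd p)) \<partial>\<pi>')"
      using ab by (intro nn_integral_mono) (simp add: ennreal_mult'[symmetric] field_simps ennreal_leI)
    also have "\<dots> = ennreal (1 / a) * (\<integral>\<^sup>+p. ennreal (d' (fst p) (snd p)) \<partial>\<pi>')"
      by (rule nn_integral_cmult) simp
    also have "\<dots> \<le> ennreal (1 / a) * (ennreal c ^ n * (\<integral>\<^sup>+p. ennreal (d' (fst p) (snd p)) \<partial>\<pi>))"
      by (intro mult_left_mono \<pi>') simp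
    also have "(\<integral>\<^sup>+p. ennreal (d' (fst p) (snd p)) \<partial>\<pi>) \<le> (\<integral>\<^sup>+p. ennreal b * ennreal (d (fst p) (snd p)) \<partial>\<pi>)"
      using ab by (intro nn_integral_mono) (simp add: ennreal_mult'[symmetric] ennreal_leI)
    also have "\<dots> = ennreal b * (\<integral>\<^sup>+p. ennreal (d (fst p) (snd p)) \<partial>\<pi>)"
      by (rule nn_integral_cmult) simp
    also have "ennreal (1 / a) * (ennreal c ^ n * (ennreal b * (\<integral>\<^sup>+p. ennreal (d (fst p) (snd p)) \<partial>\<pi>))) =
        ennreal (b / a * c ^ n) * (\<integral>\<^sup>+p. ennreal (d (fst p) (snd p)) \<partial>\<pi>)"
      using ab contr(2) by (simp add: ennreal_mult ennreal_power divide_inverse mult_ac)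
    also have "\<dots> \<le> ennreal r * (\<integral>\<^sup>+p. ennreal (d (fst p) (snd p)) \<partial>\<pi>)"
      by (intro mult_right_mono ennreal_leI r) simp
    finally show ?thesis by (simp add: mult_left_mono)
  qed
  then have "wasserstein d ?\<nu>1 ?\<nu>2 / ennreal r \<le> wasserstein d \<nu>1 \<nu>2"
    unfolding wasserstein_def[of d \<nu>1] using r(1)
    by (intro INF_greatest divide_le_posI_ennreal) (simp_all add: mult.commute)
  then have "ennreal r * (wasserstein d ?\<nu>1 ?\<nu>2 / ennreal r) \<le> ennreal r * wasserstein d \<nu>1 \<nu>2"
    by (rule mult_left_mono) simp
  then show ?thesis
    using r(1) by (simp add: ennreal_times_divide mult.commute[of "ennreal r"] ennreal_mult_divide_eq)
qed

end

text \<open>A constant in front of a geometric rate disappears at a slower rate after finitely many steps.\<close>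

lemma geometric_rate:
  fixes c C :: real
  assumes "0 \<le> c" "c < 1" "0 < C"
  obtains l n1 where "0 < l" "l < 1" "\<And>n. n \<ge> n1 \<Longrightarrow> C * c ^ n \<le> l ^ n"
proof -
  define l where "l = (1 + c) / 2"
  have l: "0 < l" "l < 1" "c < l" using assms by (auto simp: l_def)
  have "(\<lambda>n. C * (c / l) ^ n) \<longlonglongrightarrow> C * 0"
    using l assms by (intro tendsto_mult_left LIMSEQ_realpow_zero) auto
  then have "\<forall>\<^sub>F n in sequentially. C * (c / l) ^ n < 1"
    by (intro order_tendstoD) auto
  then obtain n1 where "\<And>n. n \<ge> n1 \<Longrightarrow> C * (c / l) ^ n < 1"
    by (auto simp: eventually_sequentially)
  then have "C * c ^ n \<le> l ^ n" if "n \<ge> n1" for n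
    using l that by (force simp: power_divide field_simps dest: less_imp_le)
  with l that show ?thesis by blast
qed

section \<open>The weak Harris step\<close>

lemma (in kernel_coupling) nn_integral_K_fst:
  assumes [measurable]: "g \<in> borel_measurable borel"
  shows "(\<integral>\<^sup>+p. g (fst p) \<partial>K (x, y)) = (\<integral>\<^sup>+z. g z \<partial>P x)"
  unfolding K_fst[of x y, symmetric]
  by (subst nn_integral_distr) (simp_all add: measurable_cong_sets[OF sets_K refl])

lemma (in kernel_coupling) nn_integral_K_snd:
  assumes [measurable]: "g \<in> borel_measurable borel"
  shows "(\<integral>\<^sup>+p. g (snd p) \<partial>K (x, y)) = (\<integral>\<^sup>+z. g z \<partial>P y)"
  unfolding K_snd[of x y, symmetric]
  by (subst nn_integral_distr) (simp_all add: measurable_cong_sets[OF sets_K refl])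

lemma ennreal_power2_le_imp_le: "a\<^sup>2 \<le> (ennreal r)\<^sup>2 \<Longrightarrow> 0 \<le> r \<Longrightarrow> a \<le> ennreal r"
proof (cases a)
  case top
  assume "a\<^sup>2 \<le> (ennreal r)\<^sup>2" "0 \<le> r"
  with top show ?thesis by (simp add: power2_eq_square ennreal_mult[symmetric] top_unique)
next
  case (real b)
  assume "a\<^sup>2 \<le> (ennreal r)\<^sup>2" "0 \<le> r"
  with real show ?thesis by (auto simp: ennreal_power intro!: ennreal_leI intro: power2_le_imp_le)
qed

text \<open>The expectation of \<open>sqrt (f g)\<close> is at most the square root of the product of the expectations
  of \<open>f\<close> and \<open>g\<close>. The factor \<open>f\<close> contracts through the coupling, strictly on sublevel sets of \<open>V\<close>, and
  the weight \<open>g\<close> depends on the coupling only through its marginals and contracts off these sets.\<close>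

lemma (in kernel_coupling) weak_harris_step:
  fixes f \<sigma> :: "'a \<Rightarrow> 'a \<Rightarrow> real" and V :: "'a \<Rightarrow> real"
  assumes f[measurable]: "case_prod f \<in> borel_measurable borel" and f0: "\<And>x y. 0 \<le> f x y"
    and V[measurable]: "V \<in> borel_measurable borel" and V0: "\<And>x. 0 \<le> V x"
    and contr: "\<And>x y. (\<integral>\<^sup>+p. ennreal (f (fst p) (snd p)) \<partial>K (x, y)) \<le> ennreal ((1 - \<sigma> x y) * f x y)"
    and \<sigma>: "\<And>x y. 0 \<le> \<sigma> x y" "\<And>x y. \<sigma> x y \<le> 1" 
    and \<sigma>_near: "\<And>S. \<exists>s>0. \<forall>x y. V x + V y \<le> S \<longrightarrow> s \<le> \<sigma> x y"
    and lyapunov: "\<And>x. (\<integral>\<^sup>+y. ennreal (V y) \<partial>P x) \<le> ennreal (l * V x + B)" and l: "0 \<le> l" "l < 1" and B: "0 < B"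
  obtains \<beta> c where "0 < \<beta>" "0 \<le> c" "c < 1"
    "\<And>x y. (\<integral>\<^sup>+p. ennreal (sqrt (f (fst p) (snd p) * (1 + \<beta> * (V (fst p) + V (snd p))))) \<partial>K (x, y))
      \<le> ennreal c * ennreal (sqrt (f x y * (1 + \<beta> * (V x + V y))))"
proof -
  obtain s where s: "0 < s" "\<And>x y. V x + V y \<le> 4 * B / (1 - l) \<Longrightarrow> s \<le> \<sigma> x y"
    using \<sigma>_near[of "4 * B / (1 - l)"] by blast
  have s': "0 < min s 1" "min s 1 \<le> 1" using s by auto
  obtain \<beta> c where \<beta>: "0 < \<beta>" and c: "0 \<le> c" "c < 1"
    and ineq: "\<And>S \<sigma>. 0 \<le> S \<Longrightarrow> 0 \<le> \<sigma> \<Longrightarrow> \<sigma> \<le> 1 \<Longrightarrow> (S \<le> 4 * B / (1 - l) \<Longrightarrow> min s 1 \<le> \<sigma>) \<Longrightarrow>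
      (1 - \<sigma>) * (1 + \<beta> * (l * S + 2 * B)) \<le> c\<^sup>2 * (1 + \<beta> * S)"
    using harris_real_inequality[OF l B s'] by blast
  have [measurable]: "(\<lambda>p. f (fst p) (snd p)) \<in> borel_measurable borel"
    using f by (simp add: case_prod_beta')
  show thesis
  proof (rule that[OF \<beta> c])
    fix x y
    note [measurable_cong] = sets_K[of "(x, y)"]
    let ?S = "V x + V y"
    let ?f = "\<lambda>p. f (fst p) (snd p)" and ?g = "\<lambda>p. 1 + \<beta> * (V (fst p) + V (snd p))"
    have K_total: "emeasure (K (x, y)) (space (K (x, y))) = 1"
      using measurable_space[OF K_measurable, of "(x, y)"] by (simp add: space_prob_algebra prob_space.emeasure_space_1)
    have g0: "0 \<le> ?g p" for p using \<beta> V0 by (intro add_nonneg_nonneg mult_nonneg_nonneg) auto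
    have "(\<integral>\<^sup>+p. ennreal (?g p) \<partial>K (x, y)) =
        (\<integral>\<^sup>+p. 1 + (ennreal \<beta> * ennreal (V (fst p)) + ennreal \<beta> * ennreal (V (snd p))) \<partial>K (x, y))"
      using \<beta> V0 by (intro nn_integral_cong) (simp add: ennreal_plus ennreal_mult distrib_left)
    also have "\<dots> = 1 + (ennreal \<beta> * (\<integral>\<^sup>+p. ennreal (V p) \<partial>P x) + ennreal \<beta> * (\<integral>\<^sup>+p. ennreal (V p) \<partial>P y))"
      using nn_integral_K_fst[of "\<lambda>z. ennreal (V z)"] nn_integral_K_snd[of "\<lambda>z. ennreal (V z)"]
      by (simp add: nn_integral_add nn_integral_cmult K_total)
    also have "\<dots> \<le> 1 + (ennreal \<beta> * ennreal (l * V x + B) + ennreal \<beta> * ennreal (l * V y + B))"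
      by (intro add_left_mono add_mono mult_left_mono lyapunov) simp_all
    also have "\<dots> = ennreal (1 + (\<beta> * (l * V x + B) + \<beta> * (l * V y + B)))"
      using \<beta> l B V0 by (simp add: ennreal_plus ennreal_mult)
    also have "1 + (\<beta> * (l * V x + B) + \<beta> * (l * V y + B)) = 1 + \<beta> * (l * ?S + 2 * B)"
      by (simp add: algebra_simps)
    finally have g_int: "(\<integral>\<^sup>+p. ennreal (?g p) \<partial>K (x, y)) \<le> ennreal (1 + \<beta> * (l * ?S + 2 * B))" .
    have "(\<integral>\<^sup>+p. ennreal (sqrt (?f p * ?g p)) \<partial>K (x, y))\<^sup>2 =
        (\<integral>\<^sup>+p. ennreal (sqrt (?f p)) * ennreal (sqrt (?g p)) \<partial>K (x, y))\<^sup>2"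
      using f0 g0 by (simp add: real_sqrt_mult ennreal_mult)
    also have "\<dots> \<le> (\<integral>\<^sup>+p. (ennreal (sqrt (?f p)))\<^sup>2 \<partial>K (x, y)) * (\<integral>\<^sup>+p. (ennreal (sqrt (?g p)))\<^sup>2 \<partial>K (x, y))"
      by (rule Cauchy_Schwarz_nn_integral) measurable
    also have "\<dots> = (\<integral>\<^sup>+p. ennreal (?f p) \<partial>K (x, y)) * (\<integral>\<^sup>+p. ennreal (?g p) \<partial>K (x, y))"
      using f0 g0 by (simp add: ennreal_power)
    also have "\<dots> \<le> ennreal ((1 - \<sigma> x y) * f x y) * ennreal (1 + \<beta> * (l * ?S + 2 * B))"
      by (intro mult_mono contr g_int) simp_all
    also have "\<dots> = ennreal (f x y * ((1 - \<sigma> x y) * (1 + \<beta> * (l * ?S + 2 * B))))"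
      using f0 \<sigma> by (subst ennreal_mult'[symmetric]) (simp_all add: mult_ac)
    also have "\<dots> \<le> ennreal (f x y * (c\<^sup>2 * (1 + \<beta> * ?S)))"
    proof (intro ennreal_leI mult_left_mono ineq f0 \<sigma>)
      show "0 \<le> ?S" using V0 by simp
      show "min s 1 \<le> \<sigma> x y" if "?S \<le> 4 * B / (1 - l)" using s(2)[OF that] by simp
    qed
    also have "\<dots> = (ennreal (c * sqrt (f x y * (1 + \<beta> * ?S))))\<^sup>2"
      using c f0 \<beta> V0 by (simp add: ennreal_power power_mult_distrib mult_ac)
    finally have "(\<integral>\<^sup>+p. ennreal (sqrt (?f p * ?g p)) \<partial>K (x, y)) \<le> ennreal (c * sqrt (f x y * (1 + \<beta> * ?S)))"
      using c f0 \<beta> V0 by (intro ennreal_power2_le_imp_le) auto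
    then show "(\<integral>\<^sup>+p. ennreal (sqrt (?f p * ?g p)) \<partial>K (x, y)) \<le> ennreal c * ennreal (sqrt (f x y * (1 + \<beta> * ?S)))"
      using c by (simp add: ennreal_mult')
  qed
qed

section \<open>The kernel as a random map with comparable densities\<close>

locale mtpcn = prob_space \<gamma> for \<gamma> :: "'a::{real_normed_vector, second_countable_topology} measure" +
  fixes Q :: "'a \<Rightarrow> 'a measure" and \<Phi> :: "'a \<Rightarrow> real" and \<rho> L M :: real
  assumes sets_\<gamma>[measurable_cong, simp]: "sets \<gamma> = sets borel"
    and Q_eq: "Q x = distr \<gamma> borel (\<lambda>\<xi>. \<rho> *\<^sub>R x + \<xi>)"
    and \<rho>: "0 \<le> \<rho>" "\<rho> < 1"
    and \<Phi>_bounded: "\<bar>\<Phi> x\<bar> \<le> M"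
    and \<Phi>_lipschitz: "L-lipschitz_on UNIV \<Phi>"
begin

abbreviation Z :: "'a \<Rightarrow> real" where "Z \<equiv> norm_const Q \<Phi>"

lemma L_nonneg: "0 \<le> L"
  using \<Phi>_lipschitz by (rule lipschitz_on_nonneg)

lemma \<Phi>_diff_le: "\<Phi> x - \<Phi> y \<le> L * norm (x - y)"
  using lipschitz_onD[OF \<Phi>_lipschitz, of x y] by (auto simp: dist_norm)

lemma \<Phi>_measurable[measurable]: "\<Phi> \<in> borel_measurable borel"
  using lipschitz_on_continuous_on[OF \<Phi>_lipschitz] by (rule borel_measurable_continuous_onI)

lemma exp_\<Phi>_bounds: "exp (- M) \<le> exp (- \<Phi> x)" "exp (- \<Phi> x) \<le> exp M"
  using \<Phi>_bounded[of x] by auto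

lemma Z_eq: "Z x = (\<integral>\<xi>. exp (- \<Phi> (\<rho> *\<^sub>R x + \<xi>)) \<partial>\<gamma>)"
  unfolding norm_const_def Q_eq by (subst integral_distr) auto

lemma Z_measurable[measurable]: "Z \<in> borel_measurable borel"
  unfolding Z_eq[abs_def] by measurable

lemma integrable_bounded:
  assumes "f \<in> borel_measurable borel" "\<And>x. \<bar>f x\<bar> \<le> (B :: real)"
  shows "integrable \<gamma> f"
  using assms by (intro integrable_const_bound[of _ B]) auto

lemma integrable_exp_\<Phi>: "integrable \<gamma> (\<lambda>\<xi>. exp (- \<Phi> (\<rho> *\<^sub>R x + \<xi>)))"
  by (rule integrable_bounded[where B="exp M"]) (use exp_\<Phi>_bounds in auto)

lemma Z_bounds: "exp (- M) \<le> Z x" "Z x \<le> exp M"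
proof -
  have "(\<integral>\<xi>. exp (- M) \<partial>\<gamma>) \<le> Z x" "Z x \<le> (\<integral>\<xi>. exp M \<partial>\<gamma>)"
    unfolding Z_eq by (intro integral_mono integrable_exp_\<Phi> exp_\<Phi>_bounds; simp)+
  then show "exp (- M) \<le> Z x" "Z x \<le> exp M"
    by (simp_all add: prob_space)
qed

lemma Z_pos: "0 < Z x"
  by (rule less_le_trans[OF _ Z_bounds(1)]) simp

lemma exp_\<Phi>_ratio: "exp (- \<Phi> (\<rho> *\<^sub>R x + \<xi>)) \<le> exp (L * norm (x - y)) * exp (- \<Phi> (\<rho> *\<^sub>R y + \<xi>))"
proof -
  have "\<Phi> (\<rho> *\<^sub>R y + \<xi>) - \<Phi> (\<rho> *\<^sub>R x + \<xi>) \<le> L * norm (\<rho> *\<^sub>R (y - x))"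
    using \<Phi>_diff_le[of "\<rho> *\<^sub>R y + \<xi>" "\<rho> *\<^sub>R x + \<xi>"] by (simp add: algebra_simps)
  also have "norm (\<rho> *\<^sub>R (y - x)) \<le> norm (x - y)"
    using \<rho> by (simp add: norm_minus_commute mult_left_le_one_le)
  finally show ?thesis
    using L_nonneg by (simp add: exp_add[symmetric] mult_left_mono)
qed

lemma Z_ratio: "Z x \<le> exp (L * norm (x - y)) * Z y"
  unfolding Z_eq
  by (subst integral_mult_right_zero[symmetric], intro integral_mono exp_\<Phi>_ratio integrable_exp_\<Phi> integrable_mult_right)

text \<open>The density, with respect to the noise, of the event that \<open>\<rho> x + \<xi>\<close> is proposed and accepted: the
  product of the density of the reweighted proposal with the acceptance probability.\<close>

definition move_density :: "'a \<Rightarrow> 'a \<Rightarrow> real" where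
  "move_density x \<xi> = exp (- \<Phi> (\<rho> *\<^sub>R x + \<xi>)) * min (1 / Z x) (1 / Z (\<rho> *\<^sub>R x + \<xi>))"

definition move_prob :: "'a \<Rightarrow> real" where
  "move_prob x = (\<integral>\<xi>. move_density x \<xi> \<partial>\<gamma>)"

lemma move_density_measurable[measurable (raw)]:
  assumes [measurable]: "f \<in> N \<rightarrow>\<^sub>M borel" "g \<in> N \<rightarrow>\<^sub>M borel"
  shows "(\<lambda>z. move_density (f z) (g z)) \<in> borel_measurable N"
  unfolding move_density_def by measurable

lemma move_prob_measurable[measurable]: "move_prob \<in> borel_measurable borel"
  unfolding move_prob_def[abs_def] by measurable

lemma inverse_Z_bounds: "exp (- M) \<le> 1 / Z x" "1 / Z x \<le> exp M"
  using Z_bounds[of x] Z_pos[of x] by (simp_all add: exp_minus field_simps)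

lemma move_density_lower: "exp (- 2 * M) \<le> move_density x \<xi>"
proof -
  have "exp (- M) * exp (- M) \<le> move_density x \<xi>"
    unfolding move_density_def by (intro mult_mono exp_\<Phi>_bounds) (use inverse_Z_bounds in auto)
  then show ?thesis by (simp add: exp_add[symmetric])
qed

lemma move_density_nonneg: "0 \<le> move_density x \<xi>"
  using order_trans[OF _ move_density_lower] by simp

lemma move_density_upper: "move_density x \<xi> \<le> exp (2 * M)"
proof -
  have "move_density x \<xi> \<le> exp M * exp M"
    unfolding move_density_def by (intro mult_mono exp_\<Phi>_bounds min.coboundedI1 inverse_Z_bounds) (use Z_pos in \<open>auto simp: less_imp_le\<close>)
  then show ?thesis by (simp add: exp_add[symmetric])
qed

lemma integrable_move_density: "integrable \<gamma> (move_density x)"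
  by (rule integrable_bounded[where B="exp (2 * M)"]) (use move_density_upper move_density_nonneg in auto)

lemma move_prob_bounds: "exp (- 2 * M) \<le> move_prob x" "move_prob x \<le> 1"
proof -
  have "(\<integral>\<xi>. exp (- 2 * M) \<partial>\<gamma>) \<le> move_prob x"
    unfolding move_prob_def by (intro integral_mono integrable_move_density move_density_lower) simp
  then show "exp (- 2 * M) \<le> move_prob x" by (simp add: prob_space)
  have "move_prob x \<le> (\<integral>\<xi>. exp (- \<Phi> (\<rho> *\<^sub>R x + \<xi>)) * (1 / Z x) \<partial>\<gamma>)"
    unfolding move_prob_def
  proof (intro integral_mono integrable_move_density integrable_mult_left integrable_exp_\<Phi>)
    show "move_density x \<xi> \<le> exp (- \<Phi> (\<rho> *\<^sub>R x + \<xi>)) * (1 / Z x)" for \<xi>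
      unfolding move_density_def by (intro mult_left_mono) auto
  qed
  also have "\<dots> = 1"
    using Z_pos[of x] by (simp add: Z_eq[symmetric])
  finally show "move_prob x \<le> 1" .
qed

text \<open>Each of the three factors of the density, \<open>exp (- \<Phi> (\<rho> x + \<xi>))\<close>, \<open>1 / Z x\<close> and
  \<open>1 / Z (\<rho> x + \<xi>)\<close>, changes by a factor of at most \<open>exp (L norm (x - y))\<close>; the last two are joined
  by a minimum, so only one of them counts.\<close>

lemma move_density_ratio: "exp (- (2 * L * norm (x - y))) * move_density x \<xi> \<le> move_density y \<xi>"
proof -
  let ?r = "norm (x - y)"
  have inv: "exp (- (L * ?r)) * (1 / Z a) \<le> 1 / Z b" if "norm (a - b) \<le> ?r" for a b
  proof -
    have "Z b \<le> exp (L * norm (b - a)) * Z a" by (rule Z_ratio)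
    also have "\<dots> \<le> exp (L * ?r) * Z a"
      using that L_nonneg Z_pos[of a] by (intro mult_right_mono) (auto simp: norm_minus_commute mult_left_mono)
    finally show ?thesis using Z_pos[of a] Z_pos[of b] by (simp add: exp_minus field_simps)
  qed
  have near: "norm ((\<rho> *\<^sub>R x + \<xi>) - (\<rho> *\<^sub>R y + \<xi>)) \<le> ?r"
  proof -
    have "norm ((\<rho> *\<^sub>R x + \<xi>) - (\<rho> *\<^sub>R y + \<xi>)) = norm (\<rho> *\<^sub>R (x - y))"
      by (simp add: algebra_simps)
    also have "\<dots> \<le> ?r" using \<rho> by (simp add: mult_left_le_one_le)
    finally show ?thesis .
  qed
  have "exp (- (2 * L * ?r)) * move_density x \<xi> =
      (exp (- (L * ?r)) * exp (- \<Phi> (\<rho> *\<^sub>R x + \<xi>))) *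
      min (exp (- (L * ?r)) * (1 / Z x)) (exp (- (L * ?r)) * (1 / Z (\<rho> *\<^sub>R x + \<xi>)))"
    by (simp add: move_density_def min_mult_distrib_left exp_add[symmetric] mult.assoc)
  also have "\<dots> \<le> exp (- \<Phi> (\<rho> *\<^sub>R y + \<xi>)) * min (1 / Z y) (1 / Z (\<rho> *\<^sub>R y + \<xi>))"
  proof (intro mult_mono min.mono inv near)
    show "exp (- (L * ?r)) * exp (- \<Phi> (\<rho> *\<^sub>R x + \<xi>)) \<le> exp (- \<Phi> (\<rho> *\<^sub>R y + \<xi>))"
      using exp_\<Phi>_ratio[of x \<xi> y] by (simp add: exp_minus field_simps)
  qed (use Z_pos in \<open>auto simp: less_imp_le\<close>)
  finally show ?thesis by (simp add: move_density_def)
qed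

text \<open>The flag says whether the state moves; the noise is irrelevant to a rejection and carries its
  total mass one.\<close>

definition base :: "('a \<times> bool) measure" where
  "base = \<gamma> \<Otimes>\<^sub>M count_space UNIV"

definition base_density :: "'a \<Rightarrow> 'a \<times> bool \<Rightarrow> ennreal" where
  "base_density x = (\<lambda>(\<xi>, b). ennreal (if b then move_density x \<xi> else 1 - move_prob x))"

definition base_map :: "'a \<Rightarrow> 'a \<times> bool \<Rightarrow> 'a" where
  "base_map x = (\<lambda>(\<xi>, b). if b then \<rho> *\<^sub>R x + \<xi> else x)"

lemma base_density_measurable[measurable]: "case_prod base_density \<in> borel_measurable (borel \<Otimes>\<^sub>M base)"
  unfolding base_density_def base_def case_prod_beta' by measurable

lemma base_map_measurable[measurable]: "case_prod base_map \<in> borel \<Otimes>\<^sub>M base \<rightarrow>\<^sub>M borel"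
  unfolding base_map_def base_def case_prod_beta' by measurable

lemma nn_integral_base:
  assumes g: "g \<in> borel_measurable base"
  shows "(\<integral>\<^sup>+w. g w \<partial>base) = (\<integral>\<^sup>+\<xi>. g (\<xi>, True) \<partial>\<gamma>) + (\<integral>\<^sup>+\<xi>. g (\<xi>, False) \<partial>\<gamma>)"
proof -
  interpret C: sigma_finite_measure "count_space (UNIV :: bool set)"
    by (rule sigma_finite_measure_count_space_finite) simp
  note g' = g[unfolded base_def]
  note [measurable] = g'
  have "(\<integral>\<^sup>+w. g w \<partial>base) = (\<integral>\<^sup>+\<xi>. \<integral>\<^sup>+b. g (\<xi>, b) \<partial>count_space UNIV \<partial>\<gamma>)"
    unfolding base_def by (rule C.nn_integral_fst[symmetric, OF g'])
  also have "\<dots> = (\<integral>\<^sup>+\<xi>. g (\<xi>, True) + g (\<xi>, False) \<partial>\<gamma>)"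
    by (simp add: nn_integral_count_space_finite UNIV_bool add.commute)
  finally show ?thesis by (simp add: nn_integral_add)
qed

lemma nn_integral_move_density: "(\<integral>\<^sup>+\<xi>. ennreal (move_density x \<xi>) \<partial>\<gamma>) = ennreal (move_prob x)"
  unfolding move_prob_def
  by (intro nn_integral_eq_integral integrable_move_density) (simp add: move_density_nonneg)

sublocale random_map_kernel base base_density base_map
proof (intro random_map_kernel.intro random_map_kernel_axioms.intro)
  show "sigma_finite_measure base"
    unfolding base_def
    by (intro sigma_finite_pair_measure sigma_finite_measure_axioms sigma_finite_measure_count_space_finite) simp
  show "(\<integral>\<^sup>+w. base_density x w \<partial>base) = 1" for x
  proof -
    have [measurable]: "base_density x \<in> borel_measurable base"
      using measurable_compose[OF measurable_Pair1' base_density_measurable, of x] by simp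
    have "(\<integral>\<^sup>+w. base_density x w \<partial>base) = ennreal (move_prob x) + ennreal (1 - move_prob x)"
      using emeasure_space_1
      by (subst nn_integral_base, simp) (simp add: base_density_def nn_integral_move_density)
    also have "\<dots> = ennreal 1"
      using move_prob_bounds[of x] order_trans[OF _ move_prob_bounds(1)[of x]]
      by (subst ennreal_plus[symmetric]) simp_all
    finally show ?thesis by simp
  qed
qed (rule base_density_measurable base_map_measurable)+

lemma nn_integral_kernel_split:
  assumes [measurable]: "g \<in> borel_measurable borel"
  shows "(\<integral>\<^sup>+y. g y \<partial>kernel x) =
    (\<integral>\<^sup>+\<xi>. ennreal (move_density x \<xi>) * g (\<rho> *\<^sub>R x + \<xi>) \<partial>\<gamma>) + ennreal (1 - move_prob x) * g x"
proof -
  have [measurable]: "base_density x \<in> borel_measurable base" "base_map x \<in> base \<rightarrow>\<^sub>M borel"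
    using measurable_compose[OF measurable_Pair1' base_density_measurable, of x]
      measurable_compose[OF measurable_Pair1' base_map_measurable, of x] by simp_all
  show ?thesis
    using emeasure_space_1 by (simp add: nn_integral_kernel nn_integral_base) (simp add: base_density_def base_map_def)
qed

lemma nn_integral_Qbar:
  assumes [measurable]: "g \<in> borel_measurable borel"
  shows "(\<integral>\<^sup>+y. g y \<partial>Qbar Q \<Phi> x) = (\<integral>\<^sup>+\<xi>. ennreal (exp (- \<Phi> (\<rho> *\<^sub>R x + \<xi>)) / Z x) * g (\<rho> *\<^sub>R x + \<xi>) \<partial>\<gamma>)"
  unfolding Qbar_def Q_eq[of x] by (simp add: nn_integral_density nn_integral_distr)

text \<open>Pulled back to the noise, the density of the proposal times the acceptance probability is
  \<open>move_density\<close>, so the mass of the rejections is \<open>1 - move_prob\<close>.\<close>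

theorem kernel_eq_MTpCN_inf: "kernel = MTpCN_inf Q \<Phi>"
proof
  fix x
  have acc[measurable]: "acceptance Q \<Phi> x \<in> borel_measurable borel"
    unfolding acceptance_def[abs_def] by measurable
  have acc_bounds: "0 \<le> acceptance Q \<Phi> x y" "acceptance Q \<Phi> x y \<le> 1" for y
    using Z_pos by (auto simp: acceptance_def less_imp_le)
  let ?q = "\<lambda>\<xi>. exp (- \<Phi> (\<rho> *\<^sub>R x + \<xi>)) / Z x"
  have q0: "0 \<le> ?q \<xi>" for \<xi> using Z_pos[of x] by simp
  have move: "?q \<xi> * acceptance Q \<Phi> x (\<rho> *\<^sub>R x + \<xi>) = move_density x \<xi>" for \<xi>
    using Z_pos[of x] Z_pos[of "\<rho> *\<^sub>R x + \<xi>"]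
    by (simp add: acceptance_def move_density_def min_mult_distrib_left min_mult_distrib_right field_simps)
  have "(\<integral>\<^sup>+u. ennreal (1 - acceptance Q \<Phi> x u) \<partial>Qbar Q \<Phi> x) = (\<integral>\<^sup>+\<xi>. ennreal (?q \<xi> - move_density x \<xi>) \<partial>\<gamma>)"
    using q0 acc_bounds
    by (subst nn_integral_Qbar) (simp_all add: ennreal_mult[symmetric] right_diff_distrib move[simplified])
  also have "\<dots> = ennreal (\<integral>\<xi>. ?q \<xi> - move_density x \<xi> \<partial>\<gamma>)"
  proof (rule nn_integral_eq_integral; (rule AE_I2)?)
    show "integrable \<gamma> (\<lambda>\<xi>. ?q \<xi> - move_density x \<xi>)"
      by (simp add: integrable_exp_\<Phi> integrable_move_density)
    show "0 \<le> ?q \<xi> - move_density x \<xi>" for \<xi>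
      using mult_left_mono[OF acc_bounds(2)[of "\<rho> *\<^sub>R x + \<xi>"] q0[of \<xi>]] by (simp only: move mult_1_right diff_ge_0_iff_ge)
  qed
  also have "(\<integral>\<xi>. ?q \<xi> - move_density x \<xi> \<partial>\<gamma>) = 1 - move_prob x"
    using Z_pos[of x] by (simp add: move_prob_def integrable_exp_\<Phi> integrable_move_density Z_eq[symmetric])
  finally have rej: "(\<integral>\<^sup>+u. ennreal (1 - acceptance Q \<Phi> x u) \<partial>Qbar Q \<Phi> x) = ennreal (1 - move_prob x)" .
  have "emeasure (kernel x) A =
      (\<integral>\<^sup>+y. ennreal (acceptance Q \<Phi> x y) * indicator A y \<partial>Qbar Q \<Phi> x)
       + indicator A x * (\<integral>\<^sup>+u. ennreal (1 - acceptance Q \<Phi> x u) \<partial>Qbar Q \<Phi> x)" if [measurable]: "A \<in> sets borel" for A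
  proof -
    have "emeasure (kernel x) A = (\<integral>\<^sup>+y. indicator A y \<partial>kernel x)"
      using that by (simp add: kernel_def)
    also have "\<dots> = (\<integral>\<^sup>+\<xi>. ennreal (move_density x \<xi>) * indicator A (\<rho> *\<^sub>R x + \<xi>) \<partial>\<gamma>) + ennreal (1 - move_prob x) * indicator A x"
      by (rule nn_integral_kernel_split) simp
    also have "(\<integral>\<^sup>+\<xi>. ennreal (move_density x \<xi>) * indicator A (\<rho> *\<^sub>R x + \<xi>) \<partial>\<gamma>) =
        (\<integral>\<^sup>+y. ennreal (acceptance Q \<Phi> x y) * indicator A y \<partial>Qbar Q \<Phi> x)"
      using q0 acc_bounds
      by (subst nn_integral_Qbar) (simp_all add: mult.assoc[symmetric] ennreal_mult[symmetric] move[simplified])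
    finally show ?thesis by (simp add: rej mult.commute)
  qed
  then have "measure_of UNIV (sets borel) (emeasure (kernel x)) = MTpCN_inf Q \<Phi> x"
    unfolding MTpCN_inf_def using sets.sigma_sets_eq[of "borel :: 'a measure"]
    by (intro measure_of_eq) auto
  moreover have "measure_of UNIV (sets borel) (emeasure (kernel x)) = kernel x"
    using measure_of_of_measure[of "kernel x"] by (simp add: kernel_def)
  ultimately show "kernel x = MTpCN_inf Q \<Phi> x" by simp
qed

text \<open>A move, which has probability at least \<open>exp (- 2 M)\<close> from every state, shrinks \<open>V\<close> by the factor \<open>\<rho>\<close>
  up to an integrable error, and a rejection does not change it.\<close>

lemma lyapunov:
  assumes [measurable]: "V \<in> borel_measurable borel" "W \<in> borel_measurable borel"
    and V: "\<And>x. 0 \<le> V x" and W: "\<And>\<xi>. 0 \<le> W \<xi>" and le: "\<And>x \<xi>. V (\<rho> *\<^sub>R x + \<xi>) \<le> \<rho> * V x + W \<xi>"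
    and fin: "(\<integral>\<^sup>+\<xi>. ennreal (W \<xi>) \<partial>\<gamma>) < \<infinity>"
  obtains B where "0 < B"
    "\<And>x. (\<integral>\<^sup>+y. ennreal (V y) \<partial>kernel x) \<le> ennreal ((1 - exp (- 2 * M) * (1 - \<rho>)) * V x + B)"
proof -
  obtain w where w: "0 \<le> w" "(\<integral>\<^sup>+\<xi>. ennreal (W \<xi>) \<partial>\<gamma>) = ennreal w"
    using fin by (cases "\<integral>\<^sup>+\<xi>. ennreal (W \<xi>) \<partial>\<gamma>") auto
  have "(\<integral>\<^sup>+y. ennreal (V y) \<partial>kernel x) \<le> ennreal ((1 - exp (- 2 * M) * (1 - \<rho>)) * V x + (exp (2 * M) * w + 1))" for x
  proof -
    have "(\<integral>\<^sup>+\<xi>. ennreal (move_density x \<xi>) * ennreal (V (\<rho> *\<^sub>R x + \<xi>)) \<partial>\<gamma>) \<le>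
        (\<integral>\<^sup>+\<xi>. ennreal (move_density x \<xi>) * ennreal (\<rho> * V x) + ennreal (exp (2 * M)) * ennreal (W \<xi>) \<partial>\<gamma>)"
    proof (rule nn_integral_mono)
      fix \<xi>
      have "move_density x \<xi> * V (\<rho> *\<^sub>R x + \<xi>) \<le> move_density x \<xi> * (\<rho> * V x + W \<xi>)"
        by (intro mult_left_mono le move_density_nonneg)
      also have "\<dots> \<le> move_density x \<xi> * (\<rho> * V x) + exp (2 * M) * W \<xi>"
        using W move_density_upper by (simp add: distrib_left mult_right_mono)
      finally show "ennreal (move_density x \<xi>) * ennreal (V (\<rho> *\<^sub>R x + \<xi>)) \<le>
          ennreal (move_density x \<xi>) * ennreal (\<rho> * V x) + ennreal (exp (2 * M)) * ennreal (W \<xi>)"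
        using V W \<rho> move_density_nonneg
        by (simp add: ennreal_mult[symmetric] ennreal_plus[symmetric] ennreal_leI del: ennreal_plus)
    qed
    also have "\<dots> = ennreal (move_prob x) * ennreal (\<rho> * V x) + ennreal (exp (2 * M)) * ennreal w"
      by (simp add: nn_integral_add nn_integral_multc nn_integral_cmult nn_integral_move_density w)
    finally have "(\<integral>\<^sup>+y. ennreal (V y) \<partial>kernel x) \<le>
        ennreal (move_prob x) * ennreal (\<rho> * V x) + ennreal (exp (2 * M)) * ennreal w + ennreal (1 - move_prob x) * ennreal (V x)"
      by (simp add: nn_integral_kernel_split add_right_mono)
    also have "\<dots> = ennreal (move_prob x * (\<rho> * V x) + exp (2 * M) * w + (1 - move_prob x) * V x)"
      using V w \<rho> move_prob_bounds[of x] order_trans[OF _ move_prob_bounds(1)[of x]]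
      by (simp add: ennreal_mult[symmetric] ennreal_plus[symmetric] del: ennreal_plus)
    also have "\<dots> \<le> ennreal ((1 - exp (- 2 * M) * (1 - \<rho>)) * V x + (exp (2 * M) * w + 1))"
    proof (rule ennreal_leI)
      have "exp (- 2 * M) * ((1 - \<rho>) * V x) \<le> move_prob x * ((1 - \<rho>) * V x)"
        using \<rho> V by (intro mult_right_mono move_prob_bounds) auto
      then show "move_prob x * (\<rho> * V x) + exp (2 * M) * w + (1 - move_prob x) * V x \<le>
          (1 - exp (- 2 * M) * (1 - \<rho>)) * V x + (exp (2 * M) * w + 1)"
        by (simp add: algebra_simps)
    qed
    finally show ?thesis .
  qed
  moreover have "0 < exp (2 * M) * w + 1" using w by (intro add_nonneg_pos) auto
  ultimately show ?thesis using that by blast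
qed

text \<open>The coupling bound for the saturating distance. The probability \<open>\<delta>\<close> of differing decisions is
  \<open>max (move_prob x) (move_prob y) - p\<close>, which the comparison of densities bounds by
  \<open>1 - exp (- 2 L norm (x - y))\<close>.\<close>

lemma overlap_bound:
  assumes \<eta>: "0 < \<eta>" "2 * L * \<eta> \<le> 1" and q: "3 \<le> exp (- 2 * M) * q * (1 - \<rho>)" "0 < q"
  shows "(\<integral>\<^sup>+w. overlap x y w * ennreal (saturating q (norm (base_map x w - base_map y w) / \<eta>)) \<partial>base) + defect x y
    \<le> ennreal ((1 - 1 / (q * (1 + norm (x - y) / \<eta>) ^ q)) * saturating q (norm (x - y) / \<eta>))"
proof -
  let ?r = "norm (x - y)"
  define u where "u = ?r / \<eta>"
  have u: "0 \<le> u" using \<eta> by (simp add: u_def)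
  have [measurable]: "base_density x \<in> borel_measurable base" "base_map x \<in> base \<rightarrow>\<^sub>M borel" for x
    using measurable_compose[OF measurable_Pair1' base_density_measurable, of x]
      measurable_compose[OF measurable_Pair1' base_map_measurable, of x] by simp_all
  have [measurable]: "saturating q \<in> borel_measurable borel"
    unfolding saturating_def[abs_def] by measurable
  define p where "p = (\<integral>\<xi>. min (move_density x \<xi>) (move_density y \<xi>) \<partial>\<gamma>)"
  define j where "j = 1 - max (move_prob x) (move_prob y)"
  have int_min: "integrable \<gamma> (\<lambda>\<xi>. min (move_density x \<xi>) (move_density y \<xi>))"
    by (intro integrable_min integrable_move_density)
  have p_nn: "(\<integral>\<^sup>+\<xi>. ennreal (min (move_density x \<xi>) (move_density y \<xi>)) \<partial>\<gamma>) = ennreal p"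
    unfolding p_def by (intro nn_integral_eq_integral int_min) (simp add: move_density_nonneg)
  have "(\<integral>\<xi>. exp (- 2 * M) \<partial>\<gamma>) \<le> p"
    unfolding p_def by (intro integral_mono int_min) (simp_all add: move_density_lower[simplified])
  then have p: "exp (- 2 * M) \<le> p" by (simp add: prob_space)
  have p0: "0 \<le> p" by (rule order_trans[OF _ p]) simp
  have j0: "0 \<le> j" using move_prob_bounds by (simp add: j_def)
  have p_le: "p \<le> move_prob x" "p \<le> move_prob y"
    unfolding p_def move_prob_def by (intro integral_mono int_min integrable_move_density; simp)+
  have ov: "overlap x y (\<xi>, b) = ennreal (if b then min (move_density x \<xi>) (move_density y \<xi>) else j)" for \<xi> b
  proof -
    have "min (ennreal a) (ennreal b) = ennreal (min a b)" if "0 \<le> a" "0 \<le> b" for a b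
      using that by (auto simp: min_def)
    moreover have "min (1 - move_prob x) (1 - move_prob y) = j" by (auto simp: j_def min_def max_def)
    ultimately show ?thesis
      using move_prob_bounds(2) move_density_nonneg
      by (simp add: overlap_def base_density_def)
  qed
  have norms: "norm (base_map x (\<xi>, b) - base_map y (\<xi>, b)) / \<eta> = (if b then \<rho> * u else u)" for \<xi> b
  proof -
    have "(\<rho> *\<^sub>R x + \<xi>) - (\<rho> *\<^sub>R y + \<xi>) = \<rho> *\<^sub>R (x - y)" by (simp add: algebra_simps)
    then have "norm ((\<rho> *\<^sub>R x + \<xi>) - (\<rho> *\<^sub>R y + \<xi>)) = \<rho> * ?r" using \<rho> by simp
    then show ?thesis by (simp add: base_map_def u_def)
  qed
  have "(\<integral>\<^sup>+w. overlap x y w * ennreal (saturating q (norm (base_map x w - base_map y w) / \<eta>)) \<partial>base) =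
      (\<integral>\<^sup>+\<xi>. ennreal (min (move_density x \<xi>) (move_density y \<xi>)) * ennreal (saturating q (\<rho> * u)) \<partial>\<gamma>) +
      ennreal j * ennreal (saturating q u)"
    using emeasure_space_1 by (subst nn_integral_base, measurable) (simp add: ov norms)
  also have "\<dots> = ennreal p * ennreal (saturating q (\<rho> * u)) + ennreal j * ennreal (saturating q u)"
    by (subst nn_integral_multc) (simp_all add: p_nn)
  finally have main: "(\<integral>\<^sup>+w. overlap x y w * ennreal (saturating q (norm (base_map x w - base_map y w) / \<eta>)) \<partial>base) =
    ennreal p * ennreal (saturating q (\<rho> * u)) + ennreal j * ennreal (saturating q u)" .
  have "(\<integral>\<^sup>+w. overlap x y w \<partial>base) = ennreal p + ennreal j"
    using emeasure_space_1 by (subst nn_integral_base, measurable) (simp add: ov p_nn)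
  then have "defect x y = ennreal (1 - p - j)"
    unfolding defect_def using p0 j0 by (simp add: ennreal_plus[symmetric] ennreal_minus ennreal_1[symmetric] algebra_simps del: ennreal_plus ennreal_1)
  moreover define \<delta> where "\<delta> = 1 - p - j"
  ultimately have defect: "defect x y = ennreal \<delta>" by simp
  have \<delta>: "\<delta> = max (move_prob x) (move_prob y) - p" by (simp add: \<delta>_def j_def)
  have \<delta>_bounds: "0 \<le> \<delta>" "\<delta> \<le> 1" using p_le p0 move_prob_bounds(2)[of x] move_prob_bounds(2)[of y]
    by (auto simp: \<delta> max_def)
  have "exp (- (2 * L * ?r)) * move_prob z \<le> p" if "z \<in> {x, y}" for z
  proof -
    have "exp (- (2 * L * ?r)) * move_density z \<xi> \<le> min (move_density x \<xi>) (move_density y \<xi>)" for \<xi>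
    proof -
      have "exp (- (2 * L * ?r)) * move_density z \<xi> \<le> 1 * move_density z \<xi>"
        using L_nonneg by (intro mult_right_mono move_density_nonneg) auto
      then show ?thesis
        using that move_density_ratio[of x y \<xi>] move_density_ratio[of y x \<xi>] by (auto simp: norm_minus_commute)
    qed
    then have "(\<integral>\<xi>. exp (- (2 * L * ?r)) * move_density z \<xi> \<partial>\<gamma>) \<le> p"
      unfolding p_def by (intro integral_mono int_min integrable_mult_right integrable_move_density)
    then show ?thesis by (simp add: move_prob_def)
  qed
  then have "exp (- (2 * L * ?r)) * max (move_prob x) (move_prob y) \<le> p"
    by (simp add: max_def)
  then have "\<delta> \<le> (1 - exp (- (2 * L * ?r))) * max (move_prob x) (move_prob y)"
    by (simp add: \<delta> algebra_simps)
  also have "\<dots> \<le> (1 - exp (- (2 * L * ?r))) * 1"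
    using L_nonneg move_prob_bounds(2) by (intro mult_left_mono) auto
  also have "\<dots> \<le> 2 * L * ?r"
    using exp_ge_add_one_self[of "- (2 * L * ?r)"] by simp
  also have "\<dots> = (2 * L * \<eta>) * u"
    using \<eta> by (simp add: u_def)
  also have "\<dots> \<le> u"
    using \<eta> u L_nonneg by (simp add: mult_left_le_one_le)
  finally have \<delta>_u: "\<delta> \<le> u" .
  have "p * saturating q (\<rho> * u) + j * saturating q u + \<delta> \<le> (1 - 1 / (q * (1 + u) ^ q)) * saturating q u"
    using u \<rho> q p \<delta>_bounds \<delta>_u by (intro saturating_contraction[where a="exp (- 2 * M)"]) (auto simp: \<delta>_def)
  moreover have "(\<integral>\<^sup>+w. overlap x y w * ennreal (saturating q (norm (base_map x w - base_map y w) / \<eta>)) \<partial>base) + defect x y =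
      ennreal (p * saturating q (\<rho> * u) + j * saturating q u + \<delta>)"
    unfolding main defect using p0 j0 \<delta>_bounds u \<rho> saturating_nonneg
    by (simp add: ennreal_mult[symmetric] ennreal_plus[symmetric] del: ennreal_plus)
  ultimately show ?thesis
    by (simp add: u_def[symmetric] ennreal_leI)
qed

end

section \<open>Lyapunov functions\<close>

text \<open>The common properties of the radial profiles of the functions \<open>V\<close>. Monotonicity and convexity at the
  weight \<open>\<rho>\<close> give the drift, domination by \<open>exp (c t\<^sup>2)\<close> makes its error integrable, and coercivity
  bounds the sublevel sets.\<close>

definition growth_function :: "real \<Rightarrow> real \<Rightarrow> (real \<Rightarrow> real) \<Rightarrow> bool" where
  "growth_function \<rho> c \<phi> \<longleftrightarrow> \<phi> \<in> borel_measurable borel \<and>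
     (\<forall>t\<ge>0. 0 \<le> \<phi> t) \<and> (\<forall>s t. 0 \<le> s \<longrightarrow> s \<le> t \<longrightarrow> \<phi> s \<le> \<phi> t) \<and>
     (\<forall>s\<ge>0. \<forall>t\<ge>0. \<phi> (\<rho> * s + (1 - \<rho>) * t) \<le> \<rho> * \<phi> s + (1 - \<rho>) * \<phi> t) \<and>
     (\<exists>A\<ge>0. \<forall>t\<ge>0. \<phi> (t / (1 - \<rho>)) \<le> A * exp (c * t\<^sup>2)) \<and>
     (\<forall>S. \<exists>R. \<forall>t\<ge>0. \<phi> t \<le> S \<longrightarrow> t \<le> R)"

lemma linear_le_square: "a * t \<le> c * t\<^sup>2 + a\<^sup>2 / (4 * c)" if "0 < c" for a c t :: real
proof -
  have "0 \<le> c * (t - a / (2 * c))\<^sup>2" using that by simp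
  also have "\<dots> = c * t\<^sup>2 - a * t + a\<^sup>2 / (4 * c)"
    using that by (simp add: power2_diff field_simps power2_eq_square)
  finally show ?thesis by simp
qed

lemma exp_jensen:
  fixes \<rho> :: real
  assumes "0 \<le> \<rho>" "\<rho> < 1"
  shows "exp (\<rho> * a + (1 - \<rho>) * b) \<le> \<rho> * exp a + (1 - \<rho>) * exp (b :: real)"
  using convex_onD[OF exp_convex, of "1 - \<rho>" a b] assms by (simp add: algebra_simps)

lemma square_jensen:
  fixes \<rho> :: real
  assumes "0 \<le> \<rho>" "\<rho> < 1"
  shows "(\<rho> * s + (1 - \<rho>) * t)\<^sup>2 \<le> \<rho> * s\<^sup>2 + (1 - \<rho>) * (t :: real)\<^sup>2"
proof -
  have "\<rho> * s\<^sup>2 + (1 - \<rho>) * t\<^sup>2 - (\<rho> * s + (1 - \<rho>) * t)\<^sup>2 = \<rho> * (1 - \<rho>) * (s - t)\<^sup>2"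
    by (simp add: power2_eq_square algebra_simps)
  moreover have "0 \<le> \<rho> * (1 - \<rho>) * (s - t)\<^sup>2" using assms by simp
  ultimately show ?thesis by linarith
qed

lemma power_jensen:
  fixes \<rho> :: real
  assumes "0 \<le> \<rho>" "\<rho> < 1" "0 \<le> s" "0 \<le> t"
  shows "(\<rho> * s + (1 - \<rho>) * t) ^ k \<le> \<rho> * s ^ k + (1 - \<rho>) * (t :: real) ^ k"
proof -
  have "convex_on {0..} (\<lambda>x::real. x ^ k)"
    by (cases "even k") (auto intro: convex_power_odd convex_on_subset[OF convex_power_even])
  from convex_onD[OF this, of "1 - \<rho>" s t] show ?thesis
    using assms by (simp add: algebra_simps)
qed

lemma growth_function_power:
  assumes \<rho>: "0 \<le> \<rho>" "\<rho> < 1" and c: "0 < c" and k: "1 \<le> k"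
  shows "growth_function \<rho> c (\<lambda>t. t ^ k)"
  unfolding growth_function_def
proof (intro conjI allI impI)
  show "\<exists>A\<ge>0. \<forall>t\<ge>0. (t / (1 - \<rho>)) ^ k \<le> A * exp (c * t\<^sup>2)"
  proof (intro exI[of _ "exp ((k / (1 - \<rho>))\<^sup>2 / (4 * c))"] conjI allI impI)
    fix t :: real assume t: "0 \<le> t"
    have "t / (1 - \<rho>) \<le> exp (t / (1 - \<rho>))" using exp_ge_add_one_self[of "t / (1 - \<rho>)"] by linarith
    then have "(t / (1 - \<rho>)) ^ k \<le> exp (t / (1 - \<rho>)) ^ k"
      using t \<rho> by (intro power_mono) auto
    also have "\<dots> = exp (k / (1 - \<rho>) * t)" by (simp add: exp_of_nat_mult[symmetric])
    also have "\<dots> \<le> exp (c * t\<^sup>2 + (k / (1 - \<rho>))\<^sup>2 / (4 * c))"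
      by (simp only: exp_le_cancel_iff) (rule linear_le_square[OF c])
    finally show "(t / (1 - \<rho>)) ^ k \<le> exp ((k / (1 - \<rho>))\<^sup>2 / (4 * c)) * exp (c * t\<^sup>2)"
      by (simp add: exp_add mult.commute)
  qed simp
  show "\<exists>R. \<forall>t\<ge>0. t ^ k \<le> S \<longrightarrow> t \<le> R" for S :: real
  proof (intro exI[of _ "max 1 S"] allI impI)
    fix t :: real assume "0 \<le> t" "t ^ k \<le> S"
    moreover have "t \<le> t ^ k" if "1 \<le> t" using power_increasing[OF k that] by simp
    ultimately show "t \<le> max 1 S" by (cases "1 \<le> t") auto
  qed
qed (use \<rho> in \<open>auto intro: power_mono power_jensen\<close>)

lemma growth_function_exp:
  assumes \<rho>: "0 \<le> \<rho>" "\<rho> < 1" and c: "0 < c" and v: "0 < v"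
  shows "growth_function \<rho> c (\<lambda>t. exp (v * t))"
  unfolding growth_function_def
proof (intro conjI allI impI)
  show "\<exists>A\<ge>0. \<forall>t\<ge>0. exp (v * (t / (1 - \<rho>))) \<le> A * exp (c * t\<^sup>2)"
  proof (intro exI[of _ "exp ((v / (1 - \<rho>))\<^sup>2 / (4 * c))"] conjI allI impI)
    fix t :: real
    have "exp (v / (1 - \<rho>) * t) \<le> exp (c * t\<^sup>2 + (v / (1 - \<rho>))\<^sup>2 / (4 * c))"
      by (simp only: exp_le_cancel_iff) (rule linear_le_square[OF c])
    then show "exp (v * (t / (1 - \<rho>))) \<le> exp ((v / (1 - \<rho>))\<^sup>2 / (4 * c)) * exp (c * t\<^sup>2)"
      by (simp add: exp_add mult.commute)
  qed simp
  show "exp (v * (\<rho> * s + (1 - \<rho>) * t)) \<le> \<rho> * exp (v * s) + (1 - \<rho>) * exp (v * t)" for s t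
    using exp_jensen[OF \<rho>, of "v * s" "v * t"] by (simp add: algebra_simps)
  show "\<exists>R. \<forall>t\<ge>0. exp (v * t) \<le> S \<longrightarrow> t \<le> R" for S :: real
  proof (intro exI[of _ "S / v"] allI impI)
    fix t :: real assume "exp (v * t) \<le> S"
    then have "v * t \<le> S" using exp_ge_add_one_self[of "v * t"] by linarith
    then show "t \<le> S / v" using v by (simp add: field_simps)
  qed
qed (use v in auto)

lemma growth_function_exp_square:
  assumes \<rho>: "0 \<le> \<rho>" "\<rho> < 1" and v: "0 < v" "v \<le> c * (1 - \<rho>)\<^sup>2"
  shows "growth_function \<rho> c (\<lambda>t. exp (v * t\<^sup>2))"
  unfolding growth_function_def
proof (intro conjI allI impI)
  show "\<exists>A\<ge>0. \<forall>t\<ge>0. exp (v * (t / (1 - \<rho>))\<^sup>2) \<le> A * exp (c * t\<^sup>2)"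
  proof (intro exI[of _ 1] conjI allI impI)
    fix t :: real
    have "v / (1 - \<rho>)\<^sup>2 \<le> c" using v \<rho> by (simp add: divide_le_eq)
    then have "v / (1 - \<rho>)\<^sup>2 * t\<^sup>2 \<le> c * t\<^sup>2" by (rule mult_right_mono) simp
    then show "exp (v * (t / (1 - \<rho>))\<^sup>2) \<le> 1 * exp (c * t\<^sup>2)" by (simp add: power_divide)
  qed simp
  show "exp (v * (\<rho> * s + (1 - \<rho>) * t)\<^sup>2) \<le> \<rho> * exp (v * s\<^sup>2) + (1 - \<rho>) * exp (v * t\<^sup>2)" for s t
  proof -
    have "v * (\<rho> * s + (1 - \<rho>) * t)\<^sup>2 \<le> v * (\<rho> * s\<^sup>2 + (1 - \<rho>) * t\<^sup>2)"
      using v by (intro mult_left_mono square_jensen \<rho>) auto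
    then have "exp (v * (\<rho> * s + (1 - \<rho>) * t)\<^sup>2) \<le> exp (\<rho> * (v * s\<^sup>2) + (1 - \<rho>) * (v * t\<^sup>2))"
      by (simp add: algebra_simps)
    also have "\<dots> \<le> \<rho> * exp (v * s\<^sup>2) + (1 - \<rho>) * exp (v * t\<^sup>2)" by (rule exp_jensen[OF \<rho>])
    finally show ?thesis .
  qed
  show "\<exists>R. \<forall>t\<ge>0. exp (v * t\<^sup>2) \<le> S \<longrightarrow> t \<le> R" for S :: real
  proof (intro exI[of _ "max 1 (S / v)"] allI impI)
    fix t :: real assume t: "0 \<le> t" "exp (v * t\<^sup>2) \<le> S"
    then have "v * t\<^sup>2 \<le> S" using exp_ge_add_one_self[of "v * t\<^sup>2"] by linarith
    then have "t\<^sup>2 \<le> S / v" using v by (simp add: field_simps)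
    moreover have "t \<le> t\<^sup>2" if "1 \<le> t" using power_increasing[of 1 2 t] that by simp
    ultimately show "t \<le> max 1 (S / v)" by (cases "1 \<le> t") auto
  qed
qed (use v in \<open>auto intro!: mult_left_mono power_mono\<close>)

lemma admissible_V_radial:
  assumes "0 \<le> \<rho>" "\<rho> < 1" "0 < c" "admissible_V (c * (1 - \<rho>)\<^sup>2) V"
  obtains \<phi> where "growth_function \<rho> c \<phi>" "V = (\<lambda>x. \<phi> (norm x))"
proof -
  from assms(4) consider k :: nat where "1 \<le> k" "V = (\<lambda>x. norm x ^ k)"
    | v where "0 < v" "V = (\<lambda>x. exp (v * norm x))"
    | v where "0 < v" "v \<le> c * (1 - \<rho>)\<^sup>2" "V = (\<lambda>x. exp (v * (norm x)\<^sup>2))"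
    unfolding admissible_V_def by blast
  then show thesis
  proof cases
    case (1 k)
    show thesis by (rule that[OF growth_function_power[OF assms(1-3) 1(1)] 1(2)])
  next
    case (2 v)
    show thesis by (rule that[OF growth_function_exp[OF assms(1-3) 2(1)] 2(2)])
  next
    case (3 v)
    show thesis by (rule that[OF growth_function_exp_square[OF assms(1,2) 3(1,2)] 3(3)])
  qed
qed

lemma (in mtpcn) growth_function_lyapunov:
  assumes \<phi>: "growth_function \<rho> c \<phi>" and fin: "(\<integral>\<^sup>+\<xi>. ennreal (exp (c * (norm \<xi>)\<^sup>2)) \<partial>\<gamma>) < \<infinity>"
  obtains B where "0 < B"
    "\<And>x. (\<integral>\<^sup>+y. ennreal (\<phi> (norm y)) \<partial>kernel x) \<le> ennreal ((1 - exp (- 2 * M) * (1 - \<rho>)) * \<phi> (norm x) + B)"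
proof -
  have [measurable]: "\<phi> \<in> borel_measurable borel" and \<phi>0: "\<And>t. 0 \<le> t \<Longrightarrow> 0 \<le> \<phi> t"
    and mono: "\<And>s t. 0 \<le> s \<Longrightarrow> s \<le> t \<Longrightarrow> \<phi> s \<le> \<phi> t"
    and jensen: "\<And>s t. 0 \<le> s \<Longrightarrow> 0 \<le> t \<Longrightarrow> \<phi> (\<rho> * s + (1 - \<rho>) * t) \<le> \<rho> * \<phi> s + (1 - \<rho>) * \<phi> t"
    using \<phi> by (simp_all add: growth_function_def)
  obtain A where A: "0 \<le> A" "\<And>t. 0 \<le> t \<Longrightarrow> \<phi> (t / (1 - \<rho>)) \<le> A * exp (c * t\<^sup>2)"
    using \<phi> by (auto simp: growth_function_def)
  define W where "W \<xi> = (1 - \<rho>) * \<phi> (norm \<xi> / (1 - \<rho>))" for \<xi> :: 'a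
  show thesis
  proof (rule lyapunov[of "\<lambda>x. \<phi> (norm x)" W])
    show "W \<in> borel_measurable borel" unfolding W_def by measurable
    show "0 \<le> W \<xi>" for \<xi> using \<rho> by (auto simp: W_def intro!: mult_nonneg_nonneg \<phi>0)
    show "\<phi> (norm (\<rho> *\<^sub>R x + \<xi>)) \<le> \<rho> * \<phi> (norm x) + W \<xi>" for x \<xi>
    proof -
      have "norm (\<rho> *\<^sub>R x + \<xi>) \<le> \<rho> * norm x + norm \<xi>"
        using norm_triangle_ineq[of "\<rho> *\<^sub>R x" \<xi>] \<rho> by simp
      then have "\<phi> (norm (\<rho> *\<^sub>R x + \<xi>)) \<le> \<phi> (\<rho> * norm x + (1 - \<rho>) * (norm \<xi> / (1 - \<rho>)))"
        using \<rho> by (intro mono) auto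
      also have "\<dots> \<le> \<rho> * \<phi> (norm x) + W \<xi>"
        unfolding W_def using \<rho> by (intro jensen) auto
      finally show ?thesis .
    qed
    have "(\<integral>\<^sup>+\<xi>. ennreal (W \<xi>) \<partial>\<gamma>) \<le> (\<integral>\<^sup>+\<xi>. ennreal ((1 - \<rho>) * A) * ennreal (exp (c * (norm \<xi>)\<^sup>2)) \<partial>\<gamma>)"
      using \<rho> A by (intro nn_integral_mono)
        (simp add: ennreal_mult[symmetric] W_def ennreal_leI mult.assoc mult_left_mono)
    also have "\<dots> = ennreal ((1 - \<rho>) * A) * (\<integral>\<^sup>+\<xi>. ennreal (exp (c * (norm \<xi>)\<^sup>2)) \<partial>\<gamma>)"
      by (rule nn_integral_cmult) simp
    also have "\<dots> < \<infinity>" using fin by (simp add: ennreal_mult_less_top)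
    finally show "(\<integral>\<^sup>+\<xi>. ennreal (W \<xi>) \<partial>\<gamma>) < \<infinity>" .
  qed (use \<phi>0 that in auto)
qed

section \<open>Contraction of the chain\<close>

theorem (in mtpcn) wasserstein_contraction:
  assumes \<phi>: "growth_function \<rho> c \<phi>" and fin: "(\<integral>\<^sup>+\<xi>. ennreal (exp (c * (norm \<xi>)\<^sup>2)) \<partial>\<gamma>) < \<infinity>" and \<epsilon>: "0 < \<epsilon>"
  defines "V \<equiv> (\<lambda>x. \<phi> (norm x))"
  obtains l n1 where "0 < l" "l < 1"
    "\<And>\<nu>1 \<nu>2 n. sets \<nu>1 = sets borel \<Longrightarrow> sets \<nu>2 = sets borel \<Longrightarrow> n1 \<le> n \<Longrightarrow>
      wasserstein (d_tilde V \<epsilon>) (bind \<nu>1 (kernel_pow (MTpCN_inf Q \<Phi>) n)) (bind \<nu>2 (kernel_pow (MTpCN_inf Q \<Phi>) n))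
      \<le> ennreal (l ^ n) * wasserstein (d_tilde V \<epsilon>) \<nu>1 \<nu>2"
proof -
  have [measurable]: "\<phi> \<in> borel_measurable borel" and \<phi>0: "\<And>t. 0 \<le> t \<Longrightarrow> 0 \<le> \<phi> t"
    and coercive: "\<And>S. \<exists>R. \<forall>t\<ge>0. \<phi> t \<le> S \<longrightarrow> t \<le> R"
    using \<phi> by (simp_all add: growth_function_def)
  have V0: "0 \<le> V x" for x by (simp add: V_def \<phi>0)
  have V_measurable[measurable]: "V \<in> borel_measurable borel" unfolding V_def by measurable
  define a0 where "a0 = exp (- 2 * M)"
  \<comment> \<open>large enough for the gain from common moves to exceed the loss from differing decisions\<close>
  obtain q :: nat where q: "3 / (a0 * (1 - \<rho>)) \<le> q" "0 < q"
  proof -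
    obtain q :: nat where "max 1 (3 / (a0 * (1 - \<rho>))) \<le> q" using real_arch_simple by blast
    then show ?thesis by (intro that[of q]) auto
  qed
  then have q3: "3 \<le> a0 * q * (1 - \<rho>)"
    using \<rho> by (simp add: a0_def field_simps)
  \<comment> \<open>\<open>2 L norm (x - y)\<close>, which bounds the probability of differing decisions, is at most \<open>norm (x - y) / \<eta>\<close>\<close>
  define \<eta> where "\<eta> = 1 / (2 * L + 1)"
  have \<eta>: "0 < \<eta>" "2 * L * \<eta> \<le> 1" using L_nonneg by (auto simp: \<eta>_def)
  define f where "f x y = saturating q (norm (x - y) / \<eta>)" for x y :: 'a
  define \<sigma> where "\<sigma> x y = 1 / (q * (1 + norm (x - y) / \<eta>) ^ q)" for x y :: 'a
  have f0: "0 \<le> f x y" and f1: "f x y \<le> 1" for x y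
    using \<eta> by (auto simp: f_def intro!: saturating_nonneg saturating_le_1)
  have f_measurable: "case_prod f \<in> borel_measurable borel"
    unfolding f_def saturating_def case_prod_beta' borel_prod[symmetric] by measurable
  then have f_measurable'[measurable]: "(\<lambda>p. f (fst p) (snd p)) \<in> borel_measurable borel"
    by (simp add: case_prod_beta')
  obtain K where K: "K \<in> borel \<rightarrow>\<^sub>M prob_algebra borel"
    "\<And>x y. distr (K (x, y)) borel fst = kernel x" "\<And>x y. distr (K (x, y)) borel snd = kernel y"
    and K_le: "\<And>x y g. g \<in> borel_measurable borel \<Longrightarrow> (\<And>p. g p \<le> 1) \<Longrightarrow>
      (\<integral>\<^sup>+p. g p \<partial>K (x, y)) \<le> (\<integral>\<^sup>+w. overlap x y w * g (base_map x w, base_map y w) \<partial>base) + defect x y"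
    using coupling_kernel by blast
  interpret kernel_coupling kernel K
    by (rule kernel_coupling.intro) (use K kernel_measurable in auto)
  have contr: "(\<integral>\<^sup>+p. ennreal (f (fst p) (snd p)) \<partial>K (x, y)) \<le> ennreal ((1 - \<sigma> x y) * f x y)" for x y
  proof -
    have "(\<integral>\<^sup>+p. ennreal (f (fst p) (snd p)) \<partial>K (x, y)) \<le>
        (\<integral>\<^sup>+w. overlap x y w * ennreal (f (base_map x w) (base_map y w)) \<partial>base) + defect x y"
      using K_le[of "\<lambda>p. ennreal (f (fst p) (snd p))" x y] f1 by simp
    also have "\<dots> \<le> ennreal ((1 - \<sigma> x y) * f x y)"
      unfolding f_def \<sigma>_def by (rule overlap_bound[OF \<eta> q3[unfolded a0_def] q(2)])
    finally show ?thesis .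
  qed
  have \<sigma>: "0 \<le> \<sigma> x y" "\<sigma> x y \<le> 1" for x y
  proof -
    have "1 * 1 \<le> real q * (1 + norm (x - y) / \<eta>) ^ q"
      using q \<eta> by (intro mult_mono one_le_power) auto
    then show "0 \<le> \<sigma> x y" "\<sigma> x y \<le> 1" by (auto simp: \<sigma>_def)
  qed
  have \<sigma>_near: "\<exists>s>0. \<forall>x y. V x + V y \<le> S \<longrightarrow> s \<le> \<sigma> x y" for S
  proof -
    obtain R where R: "\<And>t. 0 \<le> t \<Longrightarrow> \<phi> t \<le> S \<Longrightarrow> t \<le> R" using coercive[of S] by blast
    have "1 / (q * (1 + 2 * \<bar>R\<bar> / \<eta>) ^ q) \<le> \<sigma> x y" if "V x + V y \<le> S" for x y
    proof -
      have "V x \<le> S" "V y \<le> S" using that V0[of x] V0[of y] by linarith+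
      then have "norm x \<le> R" "norm y \<le> R" by (auto simp: V_def intro: R)
      then have "norm (x - y) \<le> 2 * \<bar>R\<bar>" using norm_triangle_ineq4[of x y] by linarith
      then show ?thesis
        unfolding \<sigma>_def using q \<eta>
        by (intro divide_left_mono mult_left_mono power_mono add_left_mono divide_right_mono mult_pos_pos zero_less_power add_pos_nonneg) auto
    qed
    moreover have "0 < 1 / (q * (1 + 2 * \<bar>R\<bar> / \<eta>) ^ q)"
      using q \<eta> by (intro divide_pos_pos mult_pos_pos zero_less_power add_pos_nonneg) auto
    ultimately show ?thesis by blast
  qed
  obtain B where B: "0 < B" and lyap: "\<And>x. (\<integral>\<^sup>+y. ennreal (V y) \<partial>kernel x) \<le> ennreal ((1 - a0 * (1 - \<rho>)) * V x + B)"
    using growth_function_lyapunov[OF \<phi> fin] unfolding V_def a0_def by blast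
  have M0: "0 \<le> M" using \<Phi>_bounded[of 0] by simp
  have l01: "0 \<le> 1 - a0 * (1 - \<rho>)" "1 - a0 * (1 - \<rho>) < 1"
    using \<rho> M0 by (auto simp: a0_def mult_le_one)
  obtain \<beta> c' where \<beta>: "0 < \<beta>" and c': "0 \<le> c'" "c' < 1" and
    harris: "\<And>x y. (\<integral>\<^sup>+p. ennreal (sqrt (f (fst p) (snd p) * (1 + \<beta> * (V (fst p) + V (snd p))))) \<partial>K (x, y))
      \<le> ennreal c' * ennreal (sqrt (f x y * (1 + \<beta> * (V x + V y))))"
    using weak_harris_step[OF f_measurable f0 V_measurable V0 contr \<sigma> \<sigma>_near lyap l01 B] by blast
  define d' where "d' x y = sqrt (f x y * (1 + \<beta> * (V x + V y)))" for x y
  obtain a b where ab: "0 < a" "0 < b"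
    "\<And>r. 0 \<le> r \<Longrightarrow> a * min 1 (r / \<epsilon>) \<le> saturating q (r / \<eta>)"
    "\<And>r. 0 \<le> r \<Longrightarrow> saturating q (r / \<eta>) \<le> b * min 1 (r / \<epsilon>)"
    using saturating_equiv[OF \<epsilon> \<eta>(1) q(2)] by blast
  have f_equiv: "a * d_eps \<epsilon> x y \<le> f x y" "f x y \<le> b * d_eps \<epsilon> x y" for x y
    unfolding d_eps_def f_def by (intro ab norm_ge_zero)+
  have d_eps0: "0 \<le> d_eps \<epsilon> x y" for x y :: 'a using \<epsilon> by (simp add: d_eps_def)
  have weight: "min 1 \<beta> * (1 + V x + V y) \<le> 1 + \<beta> * (V x + V y)"
    "1 + \<beta> * (V x + V y) \<le> max 1 \<beta> * (1 + V x + V y)" for x y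
  proof -
    have "min 1 \<beta> * (V x + V y) \<le> \<beta> * (V x + V y)" "\<beta> * (V x + V y) \<le> max 1 \<beta> * (V x + V y)"
      using V0 by (intro mult_right_mono add_nonneg_nonneg; simp)+
    moreover have "min 1 \<beta> \<le> 1" "1 \<le> max 1 \<beta>" by auto
    ultimately show "min 1 \<beta> * (1 + V x + V y) \<le> 1 + \<beta> * (V x + V y)"
      "1 + \<beta> * (V x + V y) \<le> max 1 \<beta> * (1 + V x + V y)"
      by (simp_all add: distrib_left)
  qed
  have lower: "sqrt (a * min 1 \<beta>) * d_tilde V \<epsilon> x y \<le> d' x y" for x y
  proof -
    have "(a * d_eps \<epsilon> x y) * (min 1 \<beta> * (1 + V x + V y)) \<le> f x y * (1 + \<beta> * (V x + V y))"
      using V0 \<beta> by (intro mult_mono f_equiv weight f0 mult_nonneg_nonneg add_nonneg_nonneg) auto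
    then show ?thesis
      by (simp add: d'_def d_tilde_def real_sqrt_mult[symmetric] mult_ac)
  qed
  have upper: "d' x y \<le> sqrt (b * max 1 \<beta>) * d_tilde V \<epsilon> x y" for x y
  proof -
    have "f x y * (1 + \<beta> * (V x + V y)) \<le> (b * d_eps \<epsilon> x y) * (max 1 \<beta> * (1 + V x + V y))"
      using V0 \<beta> d_eps0 ab(2) by (intro mult_mono f_equiv weight mult_nonneg_nonneg add_nonneg_nonneg) auto
    then show ?thesis
      by (simp add: d'_def d_tilde_def real_sqrt_mult[symmetric] mult_ac)
  qed
  have pos: "0 < sqrt (a * min 1 \<beta>)" "0 < sqrt (b * max 1 \<beta>)" using ab \<beta> by auto
  have d'_measurable: "case_prod d' \<in> borel_measurable borel"
    using f_measurable' unfolding d'_def case_prod_beta' borel_prod[symmetric] by measurable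
  have d_tilde_measurable: "case_prod (d_tilde V \<epsilon>) \<in> borel_measurable borel"
    unfolding d_tilde_def d_eps_def case_prod_beta' borel_prod[symmetric] by measurable
  obtain l n1 where l: "0 < l" "l < 1"
    and rate: "\<And>n. n \<ge> n1 \<Longrightarrow> sqrt (b * max 1 \<beta>) / sqrt (a * min 1 \<beta>) * c' ^ n \<le> l ^ n"
    using geometric_rate[OF c', of "sqrt (b * max 1 \<beta>) / sqrt (a * min 1 \<beta>)"] pos by (metis divide_pos_pos)
  show thesis
  proof (rule that[OF l])
    fix \<nu>1 \<nu>2 :: "'a measure" and n
    assume \<nu>: "sets \<nu>1 = sets borel" "sets \<nu>2 = sets borel" and n: "n1 \<le> n"
    have "wasserstein (d_tilde V \<epsilon>) (bind \<nu>1 (kernel_pow kernel n)) (bind \<nu>2 (kernel_pow kernel n))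
      \<le> ennreal (l ^ n) * wasserstein (d_tilde V \<epsilon>) \<nu>1 \<nu>2"
      by (rule wasserstein_kernel_pow_le[OF d'_measurable harris[folded d'_def] c'(1) pos lower upper
            d_tilde_measurable \<nu> zero_less_power[OF l(1)] rate[OF n]])
    then show "wasserstein (d_tilde V \<epsilon>) (bind \<nu>1 (kernel_pow (MTpCN_inf Q \<Phi>) n)) (bind \<nu>2 (kernel_pow (MTpCN_inf Q \<Phi>) n))
      \<le> ennreal (l ^ n) * wasserstein (d_tilde V \<epsilon>) \<nu>1 \<nu>2"
      by (simp only: kernel_eq_MTpCN_inf)
  qed
qed

theorem theorem3p3:
  fixes C :: "'a::{real_inner, complete_space, second_countable_topology} \<Rightarrow> 'a"
    and Q :: "'a \<Rightarrow> 'a measure"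
    and \<Phi> :: "'a \<Rightarrow> real"
    and \<rho> L\<Phi> :: real
  assumes "linear C" "symmetric_operator C" "strictly_positive_operator C"
    and "trace_class_operator C"
    and "0 \<le> \<rho>" "\<rho> < 1"
    and "\<And>x. is_gaussian_measure (Q x) (\<rho> *\<^sub>R x) (\<lambda>h. (1 - \<rho>\<^sup>2) *\<^sub>R C h)"
    and "bounded (range \<Phi>)"
    and "L\<Phi>-lipschitz_on UNIV \<Phi>"
  shows "\<exists>v0>0. \<forall>V. admissible_V v0 V \<longrightarrow>
    (\<exists>\<epsilon>s. 0 < \<epsilon>s \<and> \<epsilon>s < 1 \<and>
      (\<forall>\<epsilon>. 0 < \<epsilon> \<and> \<epsilon> < \<epsilon>s \<longrightarrow>
        (\<exists>(l::real) (n1::nat). 0 < l \<and> l < 1 \<and>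
          (\<forall>\<nu>1 \<nu>2 :: 'a measure.
             prob_space \<nu>1 \<and> sets \<nu>1 = sets borel \<and>
             prob_space \<nu>2 \<and> sets \<nu>2 = sets borel \<longrightarrow>
             (\<forall>n\<ge>n1.
                wasserstein (d_tilde V \<epsilon>)
                  (bind \<nu>1 (kernel_pow (MTpCN_inf Q \<Phi>) n))
                  (bind \<nu>2 (kernel_pow (MTpCN_inf Q \<Phi>) n))
                \<le> ennreal (l ^ n) * wasserstein (d_tilde V \<epsilon>) \<nu>1 \<nu>2)))))"
proof -
  let ?K = "\<lambda>h. (1 - \<rho>\<^sup>2) *\<^sub>R C h"
  have "\<rho>\<^sup>2 < 1" using assms(5,6) by (simp add: abs_square_less_1)
  then have K_nonneg: "0 \<le> ?K h \<bullet> h" for h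
    using assms(3) linear_0[OF assms(1)]
    by (cases "h = 0") (auto simp: strictly_positive_operator_def less_imp_le)
  have Q0: "prob_space (Q 0)" "sets (Q 0) = sets borel"
    using assms(7)[of 0] by (auto simp: is_gaussian_measure_def)
  have Q_translate: "Q x = distr (Q 0) borel (\<lambda>\<xi>. \<rho> *\<^sub>R x + \<xi>)" for x
    by (rule gaussian_translate[OF assms(7) K_nonneg]) simp
  interpret centered_gaussian "Q 0" "\<lambda>h. ?K h \<bullet> h"
  proof (intro centered_gaussian.intro centered_gaussian_axioms.intro Q0)
    show "(\<integral>x. iexp (x \<bullet> h) \<partial>Q 0) = of_real (exp (- (?K h \<bullet> h) / 2))" for h
      using gaussian_fourier[OF assms(7) K_nonneg, of 0 h] by (simp add: exp_of_real[symmetric])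
    show "?K (h + k) \<bullet> (h + k) + ?K (h - k) \<bullet> (h - k) = 2 * (?K h \<bullet> h) + 2 * (?K k \<bullet> k)" for h k
      by (simp add: linear_add[OF assms(1)] linear_diff[OF assms(1)] inner_add_left inner_add_right
          inner_diff_left inner_diff_right algebra_simps)
    show "?K (c *\<^sub>R h) \<bullet> (c *\<^sub>R h) = c\<^sup>2 * (?K h \<bullet> h)" for c h
      by (simp add: linear_scale[OF assms(1)] power2_eq_square)
  qed
  obtain c where c: "0 < c" "(\<integral>\<^sup>+x. ennreal (exp (c * (norm x)\<^sup>2)) \<partial>Q 0) < \<infinity>"
    using fernique by blast
  obtain M where M: "\<And>x. \<bar>\<Phi> x\<bar> \<le> M"
    using assms(8) by (auto simp: bounded_iff)
  interpret mtpcn "Q 0" Q \<Phi> \<rho> L\<Phi> M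
    by (intro mtpcn.intro mtpcn_axioms.intro Q0 Q_translate assms(5,6,9) M)
  show ?thesis
  \<comment> \<open>the drift evaluates \<open>V\<close> at \<open>\<xi> / (1 - \<rho>)\<close>, which rescales the exponent of \<open>fernique\<close> by \<open>(1 - \<rho>)\<^sup>2\<close>\<close>
  proof (rule exI[of _ "c * (1 - \<rho>)\<^sup>2"], intro conjI allI impI)
    show "0 < c * (1 - \<rho>)\<^sup>2" using c assms(6) by simp
    fix V :: "'a \<Rightarrow> real" assume "admissible_V (c * (1 - \<rho>)\<^sup>2) V"
    then obtain \<phi> where \<phi>: "growth_function \<rho> c \<phi>" and V: "V = (\<lambda>x. \<phi> (norm x))"
      using admissible_V_radial[OF assms(5,6) c(1)] by blast
    show "\<exists>\<epsilon>s. 0 < \<epsilon>s \<and> \<epsilon>s < 1 \<and>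
      (\<forall>\<epsilon>. 0 < \<epsilon> \<and> \<epsilon> < \<epsilon>s \<longrightarrow>
        (\<exists>(l::real) (n1::nat). 0 < l \<and> l < 1 \<and>
          (\<forall>\<nu>1 \<nu>2 :: 'a measure.
             prob_space \<nu>1 \<and> sets \<nu>1 = sets borel \<and>
             prob_space \<nu>2 \<and> sets \<nu>2 = sets borel \<longrightarrow>
             (\<forall>n\<ge>n1.
                wasserstein (d_tilde V \<epsilon>)
                  (bind \<nu>1 (kernel_pow (MTpCN_inf Q \<Phi>) n))
                  (bind \<nu>2 (kernel_pow (MTpCN_inf Q \<Phi>) n))
                \<le> ennreal (l ^ n) * wasserstein (d_tilde V \<epsilon>) \<nu>1 \<nu>2))))"
    proof (rule exI[of _ "1 / 2"], intro conjI allI impI)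
      fix \<epsilon> :: real assume "0 < \<epsilon> \<and> \<epsilon> < 1 / 2"
      then have "0 < \<epsilon>" by simp
      obtain l n1 where "0 < l" "l < 1"
        "\<And>\<nu>1 \<nu>2 n. sets \<nu>1 = sets borel \<Longrightarrow> sets \<nu>2 = sets borel \<Longrightarrow> n1 \<le> n \<Longrightarrow>
          wasserstein (d_tilde V \<epsilon>) (bind \<nu>1 (kernel_pow (MTpCN_inf Q \<Phi>) n)) (bind \<nu>2 (kernel_pow (MTpCN_inf Q \<Phi>) n))
          \<le> ennreal (l ^ n) * wasserstein (d_tilde V \<epsilon>) \<nu>1 \<nu>2"
        by (rule wasserstein_contraction[OF \<phi> c(2) \<open>0 < \<epsilon>\<close>, folded V]) blast
      then show "\<exists>(l::real) (n1::nat). 0 < l \<and> l < 1 \<and>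
          (\<forall>\<nu>1 \<nu>2 :: 'a measure.
             prob_space \<nu>1 \<and> sets \<nu>1 = sets borel \<and>
             prob_space \<nu>2 \<and> sets \<nu>2 = sets borel \<longrightarrow>
             (\<forall>n\<ge>n1.
                wasserstein (d_tilde V \<epsilon>)
                  (bind \<nu>1 (kernel_pow (MTpCN_inf Q \<Phi>) n))
                  (bind \<nu>2 (kernel_pow (MTpCN_inf Q \<Phi>) n))
                \<le> ennreal (l ^ n) * wasserstein (d_tilde V \<epsilon>) \<nu>1 \<nu>2))"
        by (intro exI[of _ l] exI[of _ n1] conjI allI impI) auto
    qed simp_all
  qed
qed

end
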